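(* Let $\tau,\sigma>0$, $\mu\in\mathbb{R}$, $\Delta>0$, and let $Y_0\ge0$ be an initial value with finite second moment, independent of the Gaussian variables driving the schemes. For each of the eight numerical solutions $\widetilde Y$ of the inhomogeneous geometric Brownian motion (E, M, L1, L2, S1, S2, Lin, Log; recursions in the context), put $\mathbb{E}[\widetilde Y_\infty]:=\lim_{i\to\infty}\mathbb{E}[\widetilde Y(t_i)|Y_0]$ and $\mathrm{Var}(\widetilde Y_\infty):=\lim_{i\to\infty}\mathrm{Var}(\widetilde Y(t_i)|Y_0)$, $t_i=i\Delta$. Then these limits exist and are given as follows. Euler-Maruyama and Milstein schemes: (1) If $|1-\frac\Delta\tau|<1$, then $\mathbb{E}[\widetilde Y^{E}_\infty]=\mathbb{E}[\widetilde Y^{M}_\infty]=\mu\tau$. (2) If $|1-\frac\Delta\tau|<1$ and $\Delta<2\tau-\sigma^2\tau^2$, then $\mathrm{Var}(\widetilde Y^{E}_\infty)=\dfrac{(\mu\tau)^2}{\frac{2}{\sigma^2\tau}-1-\frac{\Delta}{\sigma^2\tau^2}}$. (3) If $|1-\frac\Delta\tau|<1$ and $\Delta<\dfrac{2\tau-\sigma^2\tau^2}{\frac{\sigma^4\tau^2}{2}+1}$, then $\mathrm{Var}(\widetilde Y^{M}_\infty)=\dfrac{(\mu\tau)^2(1+\frac{\sigma^2\Delta}{2})}{\frac{2}{\sigma^2\tau}-1-\frac{\Delta}{\sigma^2\tau^2}-\frac{\sigma^2\Delta}{2}}$. Splitting schemes: (4) $\mathbb{E}[\widetilde Y^{L1}_\infty]=\mu\tau\left(\dfrac{\Delta/\tau}{e^{\Delta/\tau}-1}\right)$.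 (5) $\mathbb{E}[\widetilde Y^{L2}_\infty]=\mathbb{E}[\widetilde Y^{L1}_\infty]+\mu\Delta=\mathbb{E}[\widetilde Y^{L1}_\infty]e^{\Delta/\tau}$. (6) $\mathbb{E}[\widetilde Y^{S1}_\infty]=\mathbb{E}[\widetilde Y^{L1}_\infty]+\frac{\mu\Delta}{2}=\frac12\mathbb{E}[\widetilde Y^{L1}_\infty](1+e^{\Delta/\tau})$. (7) $\mathbb{E}[\widetilde Y^{S2}_\infty]=\mathbb{E}[\widetilde Y^{L1}_\infty]e^{\Delta/(2\tau)}$. (8) If $\sigma^2\tau<2$, then $\mathrm{Var}(\widetilde Y^{L1}_\infty)=\mathrm{Var}(\widetilde Y^{L2}_\infty)=\mathrm{Var}(\widetilde Y^{S1}_\infty)=\mathbb{E}[\widetilde Y^{L1}_\infty]^2\,\dfrac{e^{2\Delta/\tau}(e^{\Delta\sigma^2}-1)}{e^{2\Delta/\tau}-e^{\Delta\sigma^2}}$. (9) If $\sigma^2\tau<2$, then $\mathrm{Var}(\widetilde Y^{S2}_\infty)=\mathbb{E}[\widetilde Y^{L1}_\infty]^2\,\dfrac{e^{\Delta/\tau}(e^{\Delta\sigma^2/2}-1)(e^{2\Delta/\tau}+e^{\Delta\sigma^2/2})}{e^{2\Delta/\tau}-e^{\Delta\sigma^2}}$. ODE schemes: (10) $\mathbb{E}[\widetilde Y^{Lin}_\infty]=\mathbb{E}[\widetilde Y^{L1}_\infty]e^{\Delta/\tau}L$. (11) $\mathbb{E}[\widetilde Y^{Log}_\infty]=\mathbb{E}[\widetilde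 Y^{L1}_\infty]e^{\Delta/\tau}L\left(1+\sigma^2\frac{\Delta}{12}\right)$. (12) If $\sigma^2\tau<2$, then $\mathrm{Var}(\widetilde Y^{Lin}_\infty)=\mathbb{E}[\widetilde Y^{L1}_\infty]^2\,\dfrac{e^{2\Delta/\tau}\left(2L\widetilde L(e^{\Delta/\tau}-1)+\bar L(e^{\Delta/\tau}-1)^2+L^2(e^{\Delta\sigma^2}-e^{2\Delta/\tau})\right)}{e^{2\Delta/\tau}-e^{\Delta\sigma^2}}$. (13) If $\sigma^2\tau<2$, then $\mathrm{Var}(\widetilde Y^{Log}_\infty)=\mathbb{E}[\widetilde Y^{L1}_\infty]^2\,\dfrac{e^{2\Delta/\tau}\left(2K\widetilde K(e^{\Delta/\tau}-1)+\bar K(e^{\Delta/\tau}-1)^2+K^2(e^{\Delta\sigma^2}-e^{2\Delta/\tau})\right)}{e^{2\Delta/\tau}-e^{\Delta\sigma^2}}$. Here $L,\bar L,\widetilde L,K,\bar K,\widetilde K$ are the explicit functions of $(\Delta,\tau,\sigma)$ given in the context.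
   Context: The inhomogeneous geometric Brownian motion is the solution of the Itô SDE $dY(t)=(-\frac1\tau Y(t)+\mu)dt+\sigma Y(t)dW(t)$, $Y(0)=Y_0$. Let $t_i=i\Delta$. The variables $\xi_0,\xi_1,\dots$ are iid $N(0,\Delta)$ (Wiener increments); $\rho_0,\rho_1,\dots$ are iid $N(0,\Delta/12)$ and independent of the $\xi$'s; $\varphi_0,\psi_0,\varphi_1,\psi_1,\dots$ are iid $N(0,\Delta/2)$; all are independent of $Y_0$. Put $a=\frac1\tau+\frac{\sigma^2}{2}$ and $X_{i-1}=e^{-a\Delta+\sigma\xi_{i-1}}$, and $\alpha_{i-1}=\dfrac{e^{-a\Delta+\sigma\xi_{i-1}}-1}{-a\Delta+\sigma\xi_{i-1}}$ (the denominator is nonzero almost surely). All schemes start at $\widetilde Y(t_0)=Y_0$ and, writing $y=\widetilde Y(t_{i-1})$ for the same scheme, are defined for $i\ge1$ by: E (Euler-Maruyama): $\widetilde Y(t_i)=y+\Delta(-\frac1\tau y+\mu)+\sigma y\,\xi_{i-1}$. M (Milstein): $\widetilde Y(t_i)=y+\Delta(-\frac1\tau y+\mu)+\sigma y\left(\xi_{i-1}+\frac\sigma2(\xi_{i-1}^2-\Delta)\right)$. L1 (first Lie-Trotter): $\widetilde Y(t_i)=X_{i-1}(y+\mu\Delta)$. L2 (second Lie-Trotter): $\widetilde Y(t_i)=yX_{i-1}+\mu\Delta$. S1 (first Strang): $\widetilde Y(t_i)=(y+\mu\frac\Delta2)X_{i-1}+\mu\frac\Delta2$. S2 (second Strang):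 $\widetilde Y(t_i)=y\,e^{-a\Delta+\sigma(\varphi_{i-1}+\psi_{i-1})}+\mu\Delta\,e^{-a\Delta/2+\sigma\psi_{i-1}}$. Lin (piecewise linear): $\widetilde Y(t_i)=yX_{i-1}+\mu\Delta\,\alpha_{i-1}$. Log (log-ODE): $\widetilde Y(t_i)=yX_{i-1}+\mu\Delta\,\alpha_{i-1}\left(1-\sigma\rho_{i-1}+\sigma^2\left(\frac35\rho_{i-1}^2+\frac{\Delta}{30}\right)\right)$. With $\mathrm{erfi}(x)=\frac{2}{\sqrt\pi}\int_0^xe^{u^2}du$ the imaginary error function, $$L=\frac{\sqrt\pi}{\sigma\sqrt{2\Delta}}\exp\left(\frac{-(\frac1\tau+\frac{\sigma^2}2)^2\Delta}{2\sigma^2}\right)\left(\mathrm{erfi}\left[\frac{(\frac1\tau+\frac{\sigma^2}2)\sqrt\Delta}{\sigma\sqrt2}\right]+\mathrm{erfi}\left[\frac{(-\frac1\tau+\frac{\sigma^2}2)\sqrt\Delta}{\sigma\sqrt2}\right]\right),$$ $$\widetilde L=\frac{\sqrt\pi}{\sigma\sqrt{2\Delta}}\exp\left(\frac{-(\frac1\tau-\frac{\sigma^2}2)^2\Delta}{2\sigma^2}\right)\left(\mathrm{erfi}\left[\frac{(\frac1\tau-\frac{\sigma^2}2)\sqrt\Delta}{\sigma\sqrt2}\right]+\mathrm{erfi}\left[\frac{(-\frac1\tau+\frac{3\sigma^2}2)\sqrt\Delta}{\sigma\sqrt2}\right]\right),$$ $$\bar L=\frac{1}{2\sigma^3\Delta}\exp\left(\frac{-a^2\Delta}{2\sigma^2}\right)\Bigg\{-2\sigma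 e^{\frac{a\Delta}{2}\left[-4+\left(\frac1{\tau\sigma^2}+\frac12\right)\right]}\left(e^{2a\Delta}+e^{2\sigma^2\Delta}-2e^{a\Delta+\frac{\sigma^2}2\Delta}\right)$$ $$+\sqrt{2\pi\Delta}\left(\mathrm{erfi}\left[\frac{(\frac1\tau+\frac{\sigma^2}2)\sqrt\Delta}{\sigma\sqrt2}\right]a+\mathrm{erfi}\left[\frac{(\frac1\tau-\frac{3\sigma^2}2)\sqrt\Delta}{\sigma\sqrt2}\right](a-2\sigma^2)+\mathrm{erfi}\left[\frac{(\frac1\tau-\frac{\sigma^2}2)\sqrt\Delta}{\sigma\sqrt2}\right]2\left(-\frac1\tau+\frac{\sigma^2}2\right)\right)\Bigg\},$$ $$K=L\left(1+\frac{\sigma^2\Delta}{12}\right),\quad \bar K=\bar L\left(1+\frac{\sigma^2\Delta}{4}+\frac{43}{3600}\sigma^4\Delta^2\right),\quad \widetilde K=\widetilde L\left(1+\frac{\sigma^2\Delta}{12}\right).$$ *)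

theory Defs
  imports "HOL-Probability.Probability"
begin

definition sigma_of :: "'a measure \<Rightarrow> ('a \<Rightarrow> real) \<Rightarrow> 'a measure" where
  "sigma_of M Z = vimage_algebra (space M) Z borel"

definition cond_mean :: "'a measure \<Rightarrow> ('a \<Rightarrow> real) \<Rightarrow> ('a \<Rightarrow> real) \<Rightarrow> 'a \<Rightarrow> real" where
  "cond_mean M Z X = real_cond_exp M (sigma_of M Z) X"

definition cond_variance :: "'a measure \<Rightarrow> ('a \<Rightarrow> real) \<Rightarrow> ('a \<Rightarrow> real) \<Rightarrow> 'a \<Rightarrow> real" where
  "cond_variance M Z X = cond_mean M Z (\<lambda>\<omega>. (X \<omega> - cond_mean M Z X \<omega>)\<^sup>2)"

text \<open>Conditional moments are only determined up to null sets, so the limits are taken almost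
  surely.  A limiting value is almost surely unique on a probability space; the predicates below
  therefore say that the limit exists and equals the given number.\<close>

definition has_limit_mean ::
    "'a measure \<Rightarrow> ('a \<Rightarrow> real) \<Rightarrow> (nat \<Rightarrow> 'a \<Rightarrow> real) \<Rightarrow> real \<Rightarrow> bool" where
  "has_limit_mean M Y0 Y m \<longleftrightarrow> (AE \<omega> in M. (\<lambda>i. cond_mean M Y0 (Y i) \<omega>) \<longlonglongrightarrow> m)"

definition has_limit_variance ::
    "'a measure \<Rightarrow> ('a \<Rightarrow> real) \<Rightarrow> (nat \<Rightarrow> 'a \<Rightarrow> real) \<Rightarrow> real \<Rightarrow> bool" where
  "has_limit_variance M Y0 Y v \<longleftrightarrow> (AE \<omega> in M. (\<lambda>i. cond_variance M Y0 (Y i) \<omega>) \<longlonglongrightarrow> v)"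

text \<open>The argument \<open>i\<close> stands for the grid point \<open>t\<^sub>i = i \<Delta>\<close>.\<close>

definition drift_a :: "real \<Rightarrow> real \<Rightarrow> real" where
  "drift_a \<tau> \<sigma> = 1 / \<tau> + \<sigma>\<^sup>2 / 2"

definition gbm_factor :: "real \<Rightarrow> real \<Rightarrow> real \<Rightarrow> real \<Rightarrow> real" where
  "gbm_factor \<tau> \<sigma> \<Delta> x = exp (- drift_a \<tau> \<sigma> * \<Delta> + \<sigma> * x)"

text \<open>The denominator vanishes for a single value of \<open>x\<close> only, where the quotient is 0 by
  convention; this is a null event for Gaussian \<open>x\<close>.\<close>

definition lin_factor :: "real \<Rightarrow> real \<Rightarrow> real \<Rightarrow> real \<Rightarrow> real" where
  "lin_factor \<tau> \<sigma> \<Delta> x =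
     (exp (- drift_a \<tau> \<sigma> * \<Delta> + \<sigma> * x) - 1) / (- drift_a \<tau> \<sigma> * \<Delta> + \<sigma> * x)"

primrec euler_maruyama ::
    "real \<Rightarrow> real \<Rightarrow> real \<Rightarrow> real \<Rightarrow> (nat \<Rightarrow> 'a \<Rightarrow> real) \<Rightarrow> ('a \<Rightarrow> real) \<Rightarrow> nat \<Rightarrow> 'a \<Rightarrow> real" where
  "euler_maruyama \<tau> \<mu> \<sigma> \<Delta> \<xi> Y0 0 \<omega> = Y0 \<omega>"
| "euler_maruyama \<tau> \<mu> \<sigma> \<Delta> \<xi> Y0 (Suc i) \<omega> =
     (let y = euler_maruyama \<tau> \<mu> \<sigma> \<Delta> \<xi> Y0 i \<omega>
      in y + \<Delta> * (- (1 / \<tau>) * y + \<mu>) + \<sigma> * y * \<xi> i \<omega>)"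

primrec milstein ::
    "real \<Rightarrow> real \<Rightarrow> real \<Rightarrow> real \<Rightarrow> (nat \<Rightarrow> 'a \<Rightarrow> real) \<Rightarrow> ('a \<Rightarrow> real) \<Rightarrow> nat \<Rightarrow> 'a \<Rightarrow> real" where
  "milstein \<tau> \<mu> \<sigma> \<Delta> \<xi> Y0 0 \<omega> = Y0 \<omega>"
| "milstein \<tau> \<mu> \<sigma> \<Delta> \<xi> Y0 (Suc i) \<omega> =
     (let y = milstein \<tau> \<mu> \<sigma> \<Delta> \<xi> Y0 i \<omega>
      in y + \<Delta> * (- (1 / \<tau>) * y + \<mu>) + \<sigma> * y * (\<xi> i \<omega> + \<sigma> / 2 * ((\<xi> i \<omega>)\<^sup>2 - \<Delta>)))"

primrec lie_trotter1 ::
    "real \<Rightarrow> real \<Rightarrow> real \<Rightarrow> real \<Rightarrow> (nat \<Rightarrow> 'a \<Rightarrow> real) \<Rightarrow> ('a \<Rightarrow> real) \<Rightarrow> nat \<Rightarrow> 'a \<Rightarrow> real" where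
  "lie_trotter1 \<tau> \<mu> \<sigma> \<Delta> \<xi> Y0 0 \<omega> = Y0 \<omega>"
| "lie_trotter1 \<tau> \<mu> \<sigma> \<Delta> \<xi> Y0 (Suc i) \<omega> =
     gbm_factor \<tau> \<sigma> \<Delta> (\<xi> i \<omega>) * (lie_trotter1 \<tau> \<mu> \<sigma> \<Delta> \<xi> Y0 i \<omega> + \<mu> * \<Delta>)"

primrec lie_trotter2 ::
    "real \<Rightarrow> real \<Rightarrow> real \<Rightarrow> real \<Rightarrow> (nat \<Rightarrow> 'a \<Rightarrow> real) \<Rightarrow> ('a \<Rightarrow> real) \<Rightarrow> nat \<Rightarrow> 'a \<Rightarrow> real" where
  "lie_trotter2 \<tau> \<mu> \<sigma> \<Delta> \<xi> Y0 0 \<omega> = Y0 \<omega>"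
| "lie_trotter2 \<tau> \<mu> \<sigma> \<Delta> \<xi> Y0 (Suc i) \<omega> =
     lie_trotter2 \<tau> \<mu> \<sigma> \<Delta> \<xi> Y0 i \<omega> * gbm_factor \<tau> \<sigma> \<Delta> (\<xi> i \<omega>) + \<mu> * \<Delta>"

primrec strang1 ::
    "real \<Rightarrow> real \<Rightarrow> real \<Rightarrow> real \<Rightarrow> (nat \<Rightarrow> 'a \<Rightarrow> real) \<Rightarrow> ('a \<Rightarrow> real) \<Rightarrow> nat \<Rightarrow> 'a \<Rightarrow> real" where
  "strang1 \<tau> \<mu> \<sigma> \<Delta> \<xi> Y0 0 \<omega> = Y0 \<omega>"
| "strang1 \<tau> \<mu> \<sigma> \<Delta> \<xi> Y0 (Suc i) \<omega> =
     (strang1 \<tau> \<mu> \<sigma> \<Delta> \<xi> Y0 i \<omega> + \<mu> * (\<Delta> / 2)) * gbm_factor \<tau> \<sigma> \<Delta> (\<xi> i \<omega>) + \<mu> * (\<Delta> / 2)"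

primrec strang2 ::
    "real \<Rightarrow> real \<Rightarrow> real \<Rightarrow> real \<Rightarrow> (nat \<Rightarrow> 'a \<Rightarrow> real) \<Rightarrow> (nat \<Rightarrow> 'a \<Rightarrow> real) \<Rightarrow> ('a \<Rightarrow> real)
      \<Rightarrow> nat \<Rightarrow> 'a \<Rightarrow> real" where
  "strang2 \<tau> \<mu> \<sigma> \<Delta> \<phi> \<psi> Y0 0 \<omega> = Y0 \<omega>"
| "strang2 \<tau> \<mu> \<sigma> \<Delta> \<phi> \<psi> Y0 (Suc i) \<omega> =
     strang2 \<tau> \<mu> \<sigma> \<Delta> \<phi> \<psi> Y0 i \<omega> * exp (- drift_a \<tau> \<sigma> * \<Delta> + \<sigma> * (\<phi> i \<omega> + \<psi> i \<omega>))
       + \<mu> * \<Delta> * exp (- drift_a \<tau> \<sigma> * \<Delta> / 2 + \<sigma> * \<psi> i \<omega>)"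

primrec piecewise_linear ::
    "real \<Rightarrow> real \<Rightarrow> real \<Rightarrow> real \<Rightarrow> (nat \<Rightarrow> 'a \<Rightarrow> real) \<Rightarrow> ('a \<Rightarrow> real) \<Rightarrow> nat \<Rightarrow> 'a \<Rightarrow> real" where
  "piecewise_linear \<tau> \<mu> \<sigma> \<Delta> \<xi> Y0 0 \<omega> = Y0 \<omega>"
| "piecewise_linear \<tau> \<mu> \<sigma> \<Delta> \<xi> Y0 (Suc i) \<omega> =
     piecewise_linear \<tau> \<mu> \<sigma> \<Delta> \<xi> Y0 i \<omega> * gbm_factor \<tau> \<sigma> \<Delta> (\<xi> i \<omega>)
       + \<mu> * \<Delta> * lin_factor \<tau> \<sigma> \<Delta> (\<xi> i \<omega>)"

primrec log_ode ::
    "real \<Rightarrow> real \<Rightarrow> real \<Rightarrow> real \<Rightarrow> (nat \<Rightarrow> 'a \<Rightarrow> real) \<Rightarrow> (nat \<Rightarrow> 'a \<Rightarrow> real) \<Rightarrow> ('a \<Rightarrow> real)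
      \<Rightarrow> nat \<Rightarrow> 'a \<Rightarrow> real" where
  "log_ode \<tau> \<mu> \<sigma> \<Delta> \<xi> \<rho> Y0 0 \<omega> = Y0 \<omega>"
| "log_ode \<tau> \<mu> \<sigma> \<Delta> \<xi> \<rho> Y0 (Suc i) \<omega> =
     log_ode \<tau> \<mu> \<sigma> \<Delta> \<xi> \<rho> Y0 i \<omega> * gbm_factor \<tau> \<sigma> \<Delta> (\<xi> i \<omega>)
       + \<mu> * \<Delta> * lin_factor \<tau> \<sigma> \<Delta> (\<xi> i \<omega>)
         * (1 - \<sigma> * \<rho> i \<omega> + \<sigma>\<^sup>2 * (3 / 5 * (\<rho> i \<omega>)\<^sup>2 + \<Delta> / 30))"

text \<open>The interval integral is signed, so this is the odd function \<open>erfi\<close> also for \<open>x < 0\<close>.\<close>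

definition erfi :: "real \<Rightarrow> real" where
  "erfi x = 2 / sqrt pi * (LBINT u=0..ereal x. exp (u\<^sup>2))"

definition L_const :: "real \<Rightarrow> real \<Rightarrow> real \<Rightarrow> real" where
  "L_const \<tau> \<sigma> \<Delta> =
     sqrt pi / (\<sigma> * sqrt (2 * \<Delta>)) * exp (- ((1 / \<tau> + \<sigma>\<^sup>2 / 2)\<^sup>2) * \<Delta> / (2 * \<sigma>\<^sup>2))
     * (erfi ((1 / \<tau> + \<sigma>\<^sup>2 / 2) * sqrt \<Delta> / (\<sigma> * sqrt 2))
        + erfi ((- 1 / \<tau> + \<sigma>\<^sup>2 / 2) * sqrt \<Delta> / (\<sigma> * sqrt 2)))"

definition L_tilde :: "real \<Rightarrow> real \<Rightarrow> real \<Rightarrow> real" where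
  "L_tilde \<tau> \<sigma> \<Delta> =
     sqrt pi / (\<sigma> * sqrt (2 * \<Delta>)) * exp (- ((1 / \<tau> - \<sigma>\<^sup>2 / 2)\<^sup>2) * \<Delta> / (2 * \<sigma>\<^sup>2))
     * (erfi ((1 / \<tau> - \<sigma>\<^sup>2 / 2) * sqrt \<Delta> / (\<sigma> * sqrt 2))
        + erfi ((- 1 / \<tau> + 3 * \<sigma>\<^sup>2 / 2) * sqrt \<Delta> / (\<sigma> * sqrt 2)))"

definition L_bar :: "real \<Rightarrow> real \<Rightarrow> real \<Rightarrow> real" where
  "L_bar \<tau> \<sigma> \<Delta> =
     (let a = drift_a \<tau> \<sigma> in
      1 / (2 * \<sigma> ^ 3 * \<Delta>) * exp (- (a\<^sup>2) * \<Delta> / (2 * \<sigma>\<^sup>2))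
      * (- 2 * \<sigma> * exp (a * \<Delta> / 2 * (- 4 + (1 / (\<tau> * \<sigma>\<^sup>2) + 1 / 2)))
           * (exp (2 * a * \<Delta>) + exp (2 * \<sigma>\<^sup>2 * \<Delta>) - 2 * exp (a * \<Delta> + \<sigma>\<^sup>2 / 2 * \<Delta>))
         + sqrt (2 * pi * \<Delta>)
           * (erfi ((1 / \<tau> + \<sigma>\<^sup>2 / 2) * sqrt \<Delta> / (\<sigma> * sqrt 2)) * a
              + erfi ((1 / \<tau> - 3 * \<sigma>\<^sup>2 / 2) * sqrt \<Delta> / (\<sigma> * sqrt 2)) * (a - 2 * \<sigma>\<^sup>2)
              + erfi ((1 / \<tau> - \<sigma>\<^sup>2 / 2) * sqrt \<Delta> / (\<sigma> * sqrt 2))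
                  * 2 * (- 1 / \<tau> + \<sigma>\<^sup>2 / 2))))"

definition K_const :: "real \<Rightarrow> real \<Rightarrow> real \<Rightarrow> real" where
  "K_const \<tau> \<sigma> \<Delta> = L_const \<tau> \<sigma> \<Delta> * (1 + \<sigma>\<^sup>2 * \<Delta> / 12)"

definition K_bar :: "real \<Rightarrow> real \<Rightarrow> real \<Rightarrow> real" where
  "K_bar \<tau> \<sigma> \<Delta> = L_bar \<tau> \<sigma> \<Delta> * (1 + \<sigma>\<^sup>2 * \<Delta> / 4 + 43 / 3600 * \<sigma> ^ 4 * \<Delta>\<^sup>2)"

definition K_tilde :: "real \<Rightarrow> real \<Rightarrow> real \<Rightarrow> real" where
  "K_tilde \<tau> \<sigma> \<Delta> = L_tilde \<tau> \<sigma> \<Delta> * (1 + \<sigma>\<^sup>2 * \<Delta> / 12)"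

end

(* Every scheme is a random affine recursion Y_(i+1) = A_i Y_i + B_i whose pairs (A_i, B_i) are iid and
   independent of Y_0. Hence Y_i = P_i Y_0 + Q_i with (P_i, Q_i) independent of Y_0, and the conditional
   mean and variance are polynomials in Y_0 whose coefficients are moments of (P_i, Q_i). These moments
   solve scalar linear recursions driven by E A, E A^2, E B, E AB, E B^2, which gives the limits
   m = E B / (1 - E A) and (2 m E AB + E B^2) / (1 - E A^2) - m^2.

   For the ODE schemes the moments of alpha = (e^Z - 1) / Z with Z = -a Delta + sigma xi come from
   alpha = int_0^1 e^(wZ) dw, e^Z alpha = int_1^2 e^(wZ) dw and alpha^2 = int_0^2 min(w, 2 - w) e^(wZ) dw:
   exchanging the expectation with the w-integral leaves integrals of the Gaussian moment generating
   function, whose primitive is an erfi. *)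

theory Submission
  imports Defs
begin

section \<open>Conditional moments of random affine recursions\<close>

text \<open>Two kinds of independence are kept apart: the steps are independent of each other, and
  the start is independent of all noise. For the first, slope and shift of the composed maps are
  functions of a noise path, so that present and past are disjoint blocks of coordinates; for the
  second, one sigma-algebra makes all noise measurable. The start has only two moments and the
  conditional variance nests one conditional mean in another, so every product must be known
  integrable before it is conditioned; independence provides this. Stability means |E A| < 1 and E
  A^2 < 1; for the exponential factor the latter reads \<sigma>^2 \<tau> < 2. The weight min(w, 2 -
  w) is the density of a sum of two independent uniform variables on [0, 1], since alpha is the
  average of e^(wZ) over a uniform w. The moment generating function has a positive quadratic term
  in its exponent, hence erfi and not erf. All integrands are nonnegative, so Tonelli's theorem
  yields integrability along with the value.\<close>

lemma (in prob_space) indep_set_imp_indep_var: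
  fixes f g :: "'a \<Rightarrow> real"
  assumes "indep_set (sets F) (sets G)" "space F = space M" "space G = space M"
    and f: "f \<in> borel_measurable F" and g: "g \<in> borel_measurable G"
  shows "indep_var borel f borel g"
proof -
  have sub: "sets F \<subseteq> events" "sets G \<subseteq> events"
    using assms(1) unfolding indep_sets2_eq by auto
  have F: "sigma_sets (space M) {f -` A \<inter> space M |A. A \<in> sets borel} \<subseteq> sets F"
    unfolding assms(2)[symmetric] by (rule sets.sigma_sets_subset) (use f in \<open>auto intro: measurable_sets\<close>)
  have G: "sigma_sets (space M) {g -` A \<inter> space M |A. A \<in> sets borel} \<subseteq> sets G"
    unfolding assms(3)[symmetric] by (rule sets.sigma_sets_subset) (use g in \<open>auto intro: measurable_sets\<close>)
  have "f \<in> borel_measurable M" "g \<in> borel_measurable M"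
    using f g sub assms(2,3) by (auto simp: measurable_def)
  then show ?thesis
    unfolding indep_var_eq using F G assms(1) unfolding indep_sets2_eq by blast
qed

text \<open>For \<open>A\<close> in \<open>F\<close> the weight \<open>indicator A * f\<close> is
  again \<open>F\<close>-measurable, hence independent of \<open>Z\<close>, and the integral over
  \<open>A\<close> factorises; this is the characterising property of the conditional expectation.
  Integrability of the product comes from independence, so a first moment of each factor
  suffices.\<close>

lemma (in prob_space) real_cond_exp_mult_indep:
  fixes f Z :: "'a \<Rightarrow> real"
  assumes sub: "subalgebra M F" and ind: "indep_set (sets F) (sets G)" and G: "space G = space M"
    and f: "f \<in> borel_measurable F" "integrable M f"
    and Z: "Z \<in> borel_measurable G" "integrable M Z"
  shows "integrable M (\<lambda>\<omega>. f \<omega> * Z \<omega>)"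
    and "AE \<omega> in M. real_cond_exp M F (\<lambda>\<omega>. f \<omega> * Z \<omega>) \<omega> = f \<omega> * expectation Z"
proof -
  interpret finite_measure_subalgebra M F by unfold_locales (rule sub)
  have F: "space F = space M" using sub by (simp add: subalgebra_def)
  have iv: "indep_var borel h borel Z" if "h \<in> borel_measurable F" for h :: "'a \<Rightarrow> real"
    by (rule indep_set_imp_indep_var[OF ind F G that Z(1)])
  show int: "integrable M (\<lambda>\<omega>. f \<omega> * Z \<omega>)"
    by (rule indep_var_integrable[OF iv[OF f(1)] f(2) Z(2)])
  show "AE \<omega> in M. real_cond_exp M F (\<lambda>\<omega>. f \<omega> * Z \<omega>) \<omega> = f \<omega> * expectation Z"
  proof (rule real_cond_exp_charact)
    fix A assume A: "A \<in> sets F"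
    then have AM: "A \<in> sets M" using sub by (auto simp: subalgebra_def)
    have fA: "(\<lambda>\<omega>. indicator A \<omega> * f \<omega>) \<in> borel_measurable F" using f(1) A by measurable
    have iA: "integrable M (\<lambda>\<omega>. indicator A \<omega> * f \<omega>)"
      using integrable_mult_indicator[OF AM f(2)] by simp
    have "(\<integral>\<omega>\<in>A. f \<omega> * Z \<omega> \<partial>M) = (\<integral>\<omega>. (indicator A \<omega> * f \<omega>) * Z \<omega> \<partial>M)"
      by (simp add: set_lebesgue_integral_def mult.assoc)
    also have "\<dots> = (\<integral>\<omega>. indicator A \<omega> * f \<omega> \<partial>M) * expectation Z"
      by (rule indep_var_lebesgue_integral[OF iv[OF fA] iA Z(2)])
    also have "\<dots> = (\<integral>\<omega>\<in>A. f \<omega> * expectation Z \<partial>M)"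
      by (simp add: set_lebesgue_integral_def mult.assoc[symmetric])
    finally show "(\<integral>\<omega>\<in>A. f \<omega> * Z \<omega> \<partial>M) = (\<integral>\<omega>\<in>A. f \<omega> * expectation Z \<partial>M)" .
  qed (use f int in auto)
qed

section \<open>Composed affine maps as functions of the noise path\<close>

text \<open>Slope and shift of the composition of the first \<open>i\<close> affine maps, taken as
  deterministic functions of a path \<open>x\<close>; \<open>Inl i\<close> and \<open>Inr i\<close>
  index the two variables of step \<open>i\<close>. The sum type merges both noise families into
  one, so that joint independence is a single \<open>indep_vars\<close> statement.\<close>

primrec affine_slope :: "(real \<Rightarrow> real \<Rightarrow> real) \<Rightarrow> nat \<Rightarrow> (nat + nat \<Rightarrow> real) \<Rightarrow> real" where
  "affine_slope A 0 x = 1"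
| "affine_slope A (Suc i) x = A (x (Inl i)) (x (Inr i)) * affine_slope A i x"

primrec affine_shift ::
    "(real \<Rightarrow> real \<Rightarrow> real) \<Rightarrow> (real \<Rightarrow> real \<Rightarrow> real) \<Rightarrow> nat \<Rightarrow> (nat + nat \<Rightarrow> real) \<Rightarrow> real" where
  "affine_shift A B 0 x = 0"
| "affine_shift A B (Suc i) x =
     A (x (Inl i)) (x (Inr i)) * affine_shift A B i x + B (x (Inl i)) (x (Inr i))"

abbreviation past :: "nat \<Rightarrow> (nat + nat) set" where
  "past i \<equiv> Inl ` {..<i} \<union> Inr ` {..<i}"

lemma affine_slope_measurable:
  assumes A: "case_prod A \<in> borel_measurable (borel \<Otimes>\<^sub>M borel)" and "past i \<subseteq> I"
  shows "affine_slope A i \<in> borel_measurable (\<Pi>\<^sub>M k\<in>I. borel)"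
  using assms(2)
proof (induction i)
  case (Suc i)
  have IH: "affine_slope A i \<in> borel_measurable (\<Pi>\<^sub>M k\<in>I. borel)"
    using Suc by (auto simp: lessThan_Suc)
  have "(\<lambda>x. case_prod A (x (Inl i), x (Inr i))) \<in> borel_measurable (\<Pi>\<^sub>M k\<in>I. borel)"
    by (rule measurable_compose[OF _ A]) (use Suc.prems in \<open>auto simp: lessThan_Suc intro!: measurable_component_singleton\<close>)
  with IH show ?case by simp
qed (simp add: affine_slope.simps(1)[abs_def])

lemma affine_shift_measurable:
  assumes A: "case_prod A \<in> borel_measurable (borel \<Otimes>\<^sub>M borel)"
    and B: "case_prod B \<in> borel_measurable (borel \<Otimes>\<^sub>M borel)" and "past i \<subseteq> I"
  shows "affine_shift A B i \<in> borel_measurable (\<Pi>\<^sub>M k\<in>I. borel)"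
  using assms(3)
proof (induction i)
  case (Suc i)
  have IH: "affine_shift A B i \<in> borel_measurable (\<Pi>\<^sub>M k\<in>I. borel)"
    using Suc by (auto simp: lessThan_Suc)
  have "(\<lambda>x. case_prod A (x (Inl i), x (Inr i))) \<in> borel_measurable (\<Pi>\<^sub>M k\<in>I. borel)"
    "(\<lambda>x. case_prod B (x (Inl i), x (Inr i))) \<in> borel_measurable (\<Pi>\<^sub>M k\<in>I. borel)"
    by (rule measurable_compose[OF _ A] measurable_compose[OF _ B];
        use Suc.prems in \<open>auto simp: lessThan_Suc intro!: measurable_component_singleton\<close>)+
  with IH show ?case by simp
qed (simp add: affine_shift.simps(1)[abs_def])

text \<open>Independence of coordinate blocks is stated for restricted paths; only coordinates in
  \<open>past i\<close> are read, so the restriction may be dropped.\<close>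

lemma affine_slope_restrict:
  "past i \<subseteq> I \<Longrightarrow> affine_slope A i (restrict x I) = affine_slope A i x"
  by (induction i) (auto simp: lessThan_Suc)

lemma affine_shift_restrict:
  "past i \<subseteq> I \<Longrightarrow> affine_shift A B i (restrict x I) = affine_shift A B i x"
  by (induction i) (auto simp: lessThan_Suc)

section \<open>Convergence of scalar affine recursions\<close>

text \<open>The forcing term is allowed to vary because the recursions for second moments are driven
  by first moments. The distance to the fixed point contracts by \<open>r\<close>, up to the error
  of \<open>c\<close>.\<close>

lemma tendsto_affine_recursion:
  fixes m c :: "nat \<Rightarrow> real"
  assumes rec: "\<And>i. m (Suc i) = r * m i + c i" and r: "0 \<le> r" "r < 1" and c: "c \<longlonglongrightarrow> C"
  shows "m \<longlonglongrightarrow> C / (1 - r)"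
proof -
  let ?l = "C / (1 - r)"
  have rl: "r * ?l + C = ?l" using r by (simp add: field_simps)
  define e where "e i = \<bar>m i - ?l\<bar>" for i
  have step: "e (Suc i) \<le> r * e i + \<bar>c i - C\<bar>" for i
  proof -
    have "m (Suc i) - ?l = r * (m i - ?l) + (c i - C)"
      using rl rec[of i] by (simp add: algebra_simps)
    then show ?thesis
      unfolding e_def using r abs_triangle_ineq[of "r * (m i - ?l)" "c i - C"] by (simp add: abs_mult)
  qed
  have "e \<longlonglongrightarrow> 0"
  proof (rule LIMSEQ_I)
    fix \<epsilon> :: real assume "\<epsilon> > 0"
    \<comment> \<open>\<open>\<epsilon> / 2\<close> is the fixed point of
      \<open>x \<mapsto> r * x + d\<close>, so the bound below reproduces itself in each
      step.\<close>
    define d where "d = \<epsilon> * (1 - r) / 2"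
    have d: "d > 0" using \<open>\<epsilon> > 0\<close> r by (simp add: d_def)
    obtain N where N: "\<And>n. n \<ge> N \<Longrightarrow> \<bar>c n - C\<bar> < d"
      using LIMSEQ_D[OF c d] by auto
    have b: "e (N + k) \<le> r ^ k * e N + \<epsilon> / 2" for k
    proof (induction k)
      case (Suc k)
      have "e (N + Suc k) \<le> r * e (N + k) + d"
        using step[of "N + k"] N[of "N + k"] by simp
      also have "\<dots> \<le> r * (r ^ k * e N + \<epsilon> / 2) + d"
        using Suc r by (simp add: mult_left_mono)
      also have "\<dots> = r ^ Suc k * e N + \<epsilon> / 2"
        by (simp add: d_def field_simps)
      finally show ?case .
    qed (use \<open>\<epsilon> > 0\<close> in simp)
    have "(\<lambda>k. r ^ k * e N) \<longlonglongrightarrow> 0"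
      using r by (intro tendsto_mult_left_zero LIMSEQ_realpow_zero)
    then obtain K where K: "\<And>k. k \<ge> K \<Longrightarrow> \<bar>r ^ k * e N\<bar> < \<epsilon> / 2"
      using LIMSEQ_D[of _ 0 "\<epsilon> / 2"] \<open>\<epsilon> > 0\<close> by (metis diff_zero half_gt_zero real_norm_def)
    have "norm (e n - 0) < \<epsilon>" if "n \<ge> N + K" for n
    proof -
      define k where "k = n - N"
      have k: "n = N + k" "k \<ge> K" using that by (auto simp: k_def)
      then have "e n < \<epsilon>" using b[of k] K[of k] abs_ge_self[of "r ^ k * e N"] by auto
      then show ?thesis by (simp add: e_def)
    qed
    then show "\<exists>no. \<forall>n\<ge>no. norm (e n - 0) < \<epsilon>" by blast
  qed
  then have "(\<lambda>i. m i - ?l) \<longlonglongrightarrow> 0"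
    unfolding e_def by (rule tendsto_rabs_zero_cancel)
  then show ?thesis by (simp add: LIM_zero_iff)
qed

text \<open>Constant forcing has an explicit solution, which also covers negative \<open>r\<close>:
  the Euler and Milstein factors have mean 1 - \<Delta>/\<tau>, negative once \<Delta> exceeds
  \<tau>.\<close>

lemma tendsto_affine_recursion_const:
  fixes m :: "nat \<Rightarrow> real"
  assumes rec: "\<And>i. m (Suc i) = r * m i + C" and r: "\<bar>r\<bar> < 1"
  shows "m \<longlonglongrightarrow> C / (1 - r)"
proof -
  let ?l = "C / (1 - r)"
  have rl: "r * ?l + C = ?l" using r by (simp add: field_simps)
  have "m i = r ^ i * (m 0 - ?l) + ?l" for i
  proof (induction i)
    case (Suc i)
    have "m (Suc i) = r ^ Suc i * (m 0 - ?l) + (r * ?l + C)"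
      by (simp add: rec Suc algebra_simps)
    then show ?case unfolding rl .
  qed simp
  moreover have "(\<lambda>i. r ^ i * (m 0 - ?l) + ?l) \<longlonglongrightarrow> 0 * (m 0 - ?l) + ?l"
    using r by (intro tendsto_intros LIMSEQ_power_zero) simp
  ultimately show ?thesis by (metis (no_types, lifting) ext add_0 mult_zero_left)
qed

section \<open>Moments of a random affine recursion given its start\<close>

text \<open>\<open>G\<close> only carries a sigma-algebra in which the noise is measurable. Leaving
  it abstract lets the pairs (\<xi>, \<rho>) and (\<phi>, \<psi>) share one independence hypothesis
  on \<open>Y0\<close>; two variables per step suffice for every scheme.\<close>

locale independent_noise = prob_space +
  fixes G :: "'a measure" and Y0 :: "'a \<Rightarrow> real" and U V :: "nat \<Rightarrow> 'a \<Rightarrow> real"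
  assumes Y0: "Y0 \<in> borel_measurable M" "integrable M (\<lambda>\<omega>. (Y0 \<omega>)\<^sup>2)"
    and indep_noise: "indep_vars (\<lambda>_. borel) (case_sum U V) UNIV"
    and indep_start: "indep_set (sets (sigma_of M Y0)) (sets G)"
    and space_G: "space G = space M"
    and U_G: "\<And>i. U i \<in> borel_measurable G" and V_G: "\<And>i. V i \<in> borel_measurable G"

text \<open>Of the common law of the pairs (A_i, B_i) only five moments of order at most two enter a
  conditional mean or variance, so their independence of \<open>i\<close> replaces identical
  distribution.\<close>

locale random_affine_recursion = independent_noise +
  fixes A B :: "real \<Rightarrow> real \<Rightarrow> real" and Y :: "nat \<Rightarrow> 'a \<Rightarrow> real"
    and a aa b ab bb :: real
  assumes A_meas: "case_prod A \<in> borel_measurable (borel \<Otimes>\<^sub>M borel)"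
    and B_meas: "case_prod B \<in> borel_measurable (borel \<Otimes>\<^sub>M borel)"
    and A_mean: "\<And>i. has_bochner_integral M (\<lambda>\<omega>. A (U i \<omega>) (V i \<omega>)) a"
    and A_square: "\<And>i. has_bochner_integral M (\<lambda>\<omega>. (A (U i \<omega>) (V i \<omega>))\<^sup>2) aa"
    and B_mean: "\<And>i. has_bochner_integral M (\<lambda>\<omega>. B (U i \<omega>) (V i \<omega>)) b"
    and AB_mean: "\<And>i. has_bochner_integral M (\<lambda>\<omega>. A (U i \<omega>) (V i \<omega>) * B (U i \<omega>) (V i \<omega>)) ab"
    and B_square: "\<And>i. has_bochner_integral M (\<lambda>\<omega>. (B (U i \<omega>) (V i \<omega>))\<^sup>2) bb"
    and Y_0: "\<And>\<omega>. Y 0 \<omega> = Y0 \<omega>"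
    and Y_Suc: "\<And>i \<omega>. Y (Suc i) \<omega> = A (U i \<omega>) (V i \<omega>) * Y i \<omega> + B (U i \<omega>) (V i \<omega>)"
begin

definition "P i \<omega> = affine_slope A i (\<lambda>k. case_sum U V k \<omega>)"
definition "Q i \<omega> = affine_shift A B i (\<lambda>k. case_sum U V k \<omega>)"

lemma P_simps: "P 0 = (\<lambda>\<omega>. 1)" "P (Suc i) \<omega> = A (U i \<omega>) (V i \<omega>) * P i \<omega>"
  and Q_simps: "Q 0 = (\<lambda>\<omega>. 0)" "Q (Suc i) \<omega> = A (U i \<omega>) (V i \<omega>) * Q i \<omega> + B (U i \<omega>) (V i \<omega>)"
  by (simp_all add: P_def Q_def fun_eq_iff)

lemma Y_eq: "Y i \<omega> = P i \<omega> * Y0 \<omega> + Q i \<omega>"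
  by (induction i) (simp_all add: P_simps Q_simps Y_0 Y_Suc algebra_simps)

lemma step_G_measurable:
  "(\<lambda>\<omega>. A (U i \<omega>) (V i \<omega>)) \<in> borel_measurable G" "(\<lambda>\<omega>. B (U i \<omega>) (V i \<omega>)) \<in> borel_measurable G"
proof -
  have UV: "(\<lambda>\<omega>. (U i \<omega>, V i \<omega>)) \<in> G \<rightarrow>\<^sub>M borel \<Otimes>\<^sub>M borel"
    using U_G V_G by simp
  show "(\<lambda>\<omega>. A (U i \<omega>) (V i \<omega>)) \<in> borel_measurable G"
    using measurable_compose[OF UV A_meas] by simp
  show "(\<lambda>\<omega>. B (U i \<omega>) (V i \<omega>)) \<in> borel_measurable G"
    using measurable_compose[OF UV B_meas] by simp
qed

lemma PQ_G_measurable: "P i \<in> borel_measurable G" "Q i \<in> borel_measurable G"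
proof (induction i)
  case (Suc i)
  have "P (Suc i) = (\<lambda>\<omega>. A (U i \<omega>) (V i \<omega>) * P i \<omega>)"
    "Q (Suc i) = (\<lambda>\<omega>. A (U i \<omega>) (V i \<omega>) * Q i \<omega> + B (U i \<omega>) (V i \<omega>))"
    by (simp_all add: P_simps Q_simps fun_eq_iff)
  with Suc step_G_measurable[of i] show "P (Suc i) \<in> borel_measurable G" "Q (Suc i) \<in> borel_measurable G"
    by simp_all
qed (simp_all add: P_simps Q_simps)

text \<open>Step \<open>i\<close> reads the coordinates \<open>Inl i\<close> and
  \<open>Inr i\<close>, the composition before it only those in \<open>past i\<close>; disjoint
  blocks of an independent family are independent. The free functions \<open>f\<close> and
  \<open>g\<close> of a pair let one statement serve all mixed moments.\<close>

lemma indep_past: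
  assumes f: "f \<in> borel_measurable (borel \<Otimes>\<^sub>M borel)" and g: "g \<in> borel_measurable (borel \<Otimes>\<^sub>M borel)"
  shows "indep_var borel (\<lambda>\<omega>. f (A (U i \<omega>) (V i \<omega>), B (U i \<omega>) (V i \<omega>)))
    borel (\<lambda>\<omega>. g (P i \<omega>, Q i \<omega>) :: real)"
proof -
  let ?S = "case_sum U V" and ?now = "{Inl i, Inr i} :: (nat + nat) set"
  have "indep_var (PiM ?now (\<lambda>_. borel)) (\<lambda>\<omega>. restrict (\<lambda>k. ?S k \<omega>) ?now)
     (PiM (past i) (\<lambda>_. borel)) (\<lambda>\<omega>. restrict (\<lambda>k. ?S k \<omega>) (past i))"
    by (rule indep_var_restrict[OF indep_noise]) auto
  moreover
  have UV: "(\<lambda>x. (x (Inl i), x (Inr i))) \<in> PiM ?now (\<lambda>_. borel) \<rightarrow>\<^sub>M borel \<Otimes>\<^sub>M borel"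
    by (auto intro!: measurable_Pair measurable_component_singleton)
  have "(\<lambda>x. f (A (x (Inl i)) (x (Inr i)), B (x (Inl i)) (x (Inr i))))
      \<in> borel_measurable (PiM ?now (\<lambda>_. borel))"
    using measurable_compose[OF UV A_meas] measurable_compose[OF UV B_meas]
    by (intro measurable_compose[OF _ f] measurable_Pair) simp_all
  moreover have "(\<lambda>x. g (affine_slope A i x, affine_shift A B i x)) \<in> borel_measurable (PiM (past i) (\<lambda>_. borel))"
    by (intro measurable_compose[OF _ g] measurable_Pair affine_slope_measurable affine_shift_measurable
        A_meas B_meas subset_refl)
  ultimately have "indep_var borel
      ((\<lambda>x. f (A (x (Inl i)) (x (Inr i)), B (x (Inl i)) (x (Inr i)))) \<circ> (\<lambda>\<omega>. restrict (\<lambda>k. ?S k \<omega>) ?now))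
      borel ((\<lambda>x. g (affine_slope A i x, affine_shift A B i x)) \<circ> (\<lambda>\<omega>. restrict (\<lambda>k. ?S k \<omega>) (past i)))"
    by (rule indep_var_compose)
  then show ?thesis
    by (simp add: comp_def P_def Q_def affine_slope_restrict affine_shift_restrict)
qed

lemma has_bochner_integral_past:
  assumes "f \<in> borel_measurable (borel \<Otimes>\<^sub>M borel)" "g \<in> borel_measurable (borel \<Otimes>\<^sub>M borel)"
    and "has_bochner_integral M (\<lambda>\<omega>. f (A (U i \<omega>) (V i \<omega>), B (U i \<omega>) (V i \<omega>))) x"
    and "has_bochner_integral M (\<lambda>\<omega>. g (P i \<omega>, Q i \<omega>)) (y::real)"
  shows "has_bochner_integral M (\<lambda>\<omega>. f (A (U i \<omega>) (V i \<omega>), B (U i \<omega>) (V i \<omega>)) * g (P i \<omega>, Q i \<omega>)) (x * y)"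
  using indep_var_integrable[OF indep_past[OF assms(1,2)]] indep_var_lebesgue_integral[OF indep_past[OF assms(1,2)]] assms(3,4)
  by (auto simp: has_bochner_integral_iff)

text \<open>The expectations of \<open>Q i\<close>, \<open>P i * Q i\<close> and
  \<open>(Q i)^2\<close>, read off by multiplying out one step and factorising the means of present
  and past.\<close>

primrec q :: "nat \<Rightarrow> real" where "q 0 = 0" | "q (Suc i) = a * q i + b"
primrec pq :: "nat \<Rightarrow> real" where "pq 0 = 0" | "pq (Suc i) = aa * pq i + ab * a ^ i"
primrec qq :: "nat \<Rightarrow> real" where "qq 0 = 0" | "qq (Suc i) = aa * qq i + (2 * ab * q i + bb)"

text \<open>The five moments go through one induction because each product moment needs lower ones
  at the previous step. \<open>has_bochner_integral\<close> carries integrability with the value,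
  which allows the mean of each expanded sum to be split.\<close>

lemma moments:
  "has_bochner_integral M (P i) (a ^ i) \<and> has_bochner_integral M (Q i) (q i)
   \<and> has_bochner_integral M (\<lambda>\<omega>. (P i \<omega>)\<^sup>2) (aa ^ i) \<and> has_bochner_integral M (\<lambda>\<omega>. P i \<omega> * Q i \<omega>) (pq i)
   \<and> has_bochner_integral M (\<lambda>\<omega>. (Q i \<omega>)\<^sup>2) (qq i)"
proof (induction i)
  case 0
  have "has_bochner_integral M (\<lambda>\<omega>. 1 :: real) 1"
    by (simp add: has_bochner_integral_iff prob_space)
  then show ?case by (simp add: P_simps Q_simps has_bochner_integral_zero)
next
  case (Suc i)
  let ?A = "\<lambda>\<omega>. A (U i \<omega>) (V i \<omega>)" and ?B = "\<lambda>\<omega>. B (U i \<omega>) (V i \<omega>)"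
  note IH = Suc.IH[THEN conjunct1] Suc.IH[THEN conjunct2, THEN conjunct1]
    Suc.IH[THEN conjunct2, THEN conjunct2, THEN conjunct1]
    Suc.IH[THEN conjunct2, THEN conjunct2, THEN conjunct2, THEN conjunct1]
    Suc.IH[THEN conjunct2, THEN conjunct2, THEN conjunct2, THEN conjunct2]
  have AP: "has_bochner_integral M (\<lambda>\<omega>. ?A \<omega> * P i \<omega>) (a * a ^ i)"
    using has_bochner_integral_past[of fst fst i] A_mean IH by simp
  have AQ: "has_bochner_integral M (\<lambda>\<omega>. ?A \<omega> * Q i \<omega>) (a * q i)"
    using has_bochner_integral_past[of fst snd i] A_mean IH by simp
  have AAPP: "has_bochner_integral M (\<lambda>\<omega>. (?A \<omega>)\<^sup>2 * (P i \<omega>)\<^sup>2) (aa * aa ^ i)"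
    using has_bochner_integral_past[of "\<lambda>z. (fst z)\<^sup>2" "\<lambda>z. (fst z)\<^sup>2" i] A_square IH by simp
  have AAPQ: "has_bochner_integral M (\<lambda>\<omega>. (?A \<omega>)\<^sup>2 * (P i \<omega> * Q i \<omega>)) (aa * pq i)"
    using has_bochner_integral_past[of "\<lambda>z. (fst z)\<^sup>2" "\<lambda>z. fst z * snd z" i] A_square IH by simp
  have ABP: "has_bochner_integral M (\<lambda>\<omega>. (?A \<omega> * ?B \<omega>) * P i \<omega>) (ab * a ^ i)"
    using has_bochner_integral_past[of "\<lambda>z. fst z * snd z" fst i] AB_mean IH by simp
  have AAQQ: "has_bochner_integral M (\<lambda>\<omega>. (?A \<omega>)\<^sup>2 * (Q i \<omega>)\<^sup>2) (aa * qq i)"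
    using has_bochner_integral_past[of "\<lambda>z. (fst z)\<^sup>2" "\<lambda>z. (snd z)\<^sup>2" i] A_square IH by simp
  have ABQ: "has_bochner_integral M (\<lambda>\<omega>. (?A \<omega> * ?B \<omega>) * Q i \<omega>) (ab * q i)"
    using has_bochner_integral_past[of "\<lambda>z. fst z * snd z" snd i] AB_mean IH by simp
  show ?case
  proof (intro conjI)
    show "has_bochner_integral M (P (Suc i)) (a ^ Suc i)"
      using AP by (simp add: P_simps[abs_def])
    show "has_bochner_integral M (Q (Suc i)) (q (Suc i))"
      using has_bochner_integral_add[OF AQ B_mean] by (simp add: Q_simps[abs_def])
    show "has_bochner_integral M (\<lambda>\<omega>. (P (Suc i) \<omega>)\<^sup>2) (aa ^ Suc i)"
      using AAPP by (simp add: P_simps power_mult_distrib)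
    show "has_bochner_integral M (\<lambda>\<omega>. P (Suc i) \<omega> * Q (Suc i) \<omega>) (pq (Suc i))"
      using has_bochner_integral_add[OF AAPQ ABP]
      by (simp add: P_simps Q_simps power2_eq_square algebra_simps)
    show "has_bochner_integral M (\<lambda>\<omega>. (Q (Suc i) \<omega>)\<^sup>2) (qq (Suc i))"
      using has_bochner_integral_add[OF has_bochner_integral_add[OF AAQQ has_bochner_integral_mult_right[OF ABQ, of 2]] B_square]
      by (simp add: Q_simps power2_eq_square algebra_simps)
  qed
qed

lemma subalgebra_sigma_of: "subalgebra M (sigma_of M Y0)"
  using Y0(1) unfolding subalgebra_def sigma_of_def by (simp add: measurable_iff_sets)

lemma Y0_sigma_of: "Y0 \<in> borel_measurable (sigma_of M Y0)"
  unfolding sigma_of_def by (rule measurable_vimage_algebra1) simp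

lemma Y0_integrable: "integrable M Y0"
  by (rule square_integrable_imp_integrable[OF Y0])

lemma cond_mean_indep:
  assumes "f \<in> borel_measurable (sigma_of M Y0)" "integrable M f"
    and "Z \<in> borel_measurable G" "has_bochner_integral M Z z"
  shows "integrable M (\<lambda>\<omega>. f \<omega> * Z \<omega>)" "AE \<omega> in M. cond_mean M Y0 (\<lambda>\<omega>. f \<omega> * Z \<omega>) \<omega> = f \<omega> * z"
  using real_cond_exp_mult_indep[OF subalgebra_sigma_of indep_start space_G assms(1,2,3)] assms(4)
  unfolding cond_mean_def by (auto simp: has_bochner_integral_iff)

lemma cond_mean_add:
  assumes "integrable M f" "integrable M g"
    "AE \<omega> in M. cond_mean M Y0 f \<omega> = f' \<omega>" "AE \<omega> in M. cond_mean M Y0 g \<omega> = g' \<omega>"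
  shows "AE \<omega> in M. cond_mean M Y0 (\<lambda>\<omega>. f \<omega> + g \<omega>) \<omega> = f' \<omega> + g' \<omega>"
proof -
  interpret finite_measure_subalgebra M "sigma_of M Y0" by unfold_locales (rule subalgebra_sigma_of)
  show ?thesis
    using real_cond_exp_add[OF assms(1,2)] assms(3,4) unfolding cond_mean_def by eventually_elim simp
qed

lemma cond_mean_Y: "AE \<omega> in M. cond_mean M Y0 (Y i) \<omega> = a ^ i * Y0 \<omega> + q i"
proof -
  \<comment> \<open>The factor 1 brings both summands into the form required by
    \<open>cond_mean_indep\<close>: a function of \<open>Y0\<close> times a function of the
    noise.\<close>
  have eq: "Y i = (\<lambda>\<omega>. Y0 \<omega> * P i \<omega> + 1 * Q i \<omega>)" by (auto simp: Y_eq)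
  have "AE \<omega> in M. cond_mean M Y0 (Y i) \<omega> = Y0 \<omega> * a ^ i + 1 * q i"
    unfolding eq using moments[of i]
    by (intro cond_mean_add cond_mean_indep Y0_sigma_of Y0_integrable PQ_G_measurable) auto
  then show ?thesis by (simp add: mult.commute)
qed

lemma has_limit_meanI:
  assumes "\<bar>a\<bar> < 1"
  shows "has_limit_mean M Y0 Y (b / (1 - a))"
proof -
  have q: "q \<longlonglongrightarrow> b / (1 - a)"
    by (rule tendsto_affine_recursion_const[OF _ assms]) simp
  \<comment> \<open>The exceptional null set depends on \<open>i\<close>; countably many are merged
    before the limit is taken.\<close>
  have "AE \<omega> in M. \<forall>i. cond_mean M Y0 (Y i) \<omega> = a ^ i * Y0 \<omega> + q i"
    using cond_mean_Y by (simp add: AE_all_countable)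
  then show ?thesis
    unfolding has_limit_mean_def
  proof eventually_elim
    case (elim \<omega>)
    have "(\<lambda>i. a ^ i * Y0 \<omega> + q i) \<longlonglongrightarrow> 0 * Y0 \<omega> + b / (1 - a)"
      using assms by (intro tendsto_intros LIMSEQ_power_zero q) simp
    with elim show ?case by simp
  qed
qed

text \<open>The coefficients are Var \<open>P i\<close>, twice Cov(\<open>P i\<close>,
  \<open>Q i\<close>) and Var \<open>Q i\<close>. Centring \<open>P i\<close> and \<open>Q i\<close>
  at their means expresses the deviation of \<open>Y i\<close> from its conditional mean by
  \<open>Y0\<close> and noise, and the square expands into three products to which independence
  applies.\<close>

lemma cond_variance_Y:
  "AE \<omega> in M. cond_variance M Y0 (Y i) \<omega>
     = (aa ^ i - (a ^ i)\<^sup>2) * (Y0 \<omega>)\<^sup>2 + 2 * (pq i - a ^ i * q i) * Y0 \<omega> + (qq i - (q i)\<^sup>2)"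
proof -
  interpret finite_measure_subalgebra M "sigma_of M Y0" by unfold_locales (rule subalgebra_sigma_of)
  have sub: "borel_measurable G \<subseteq> (borel_measurable M :: ('a \<Rightarrow> real) set)"
    using indep_start space_G unfolding indep_sets2_eq by (auto simp: measurable_def)
  have subF: "borel_measurable (sigma_of M Y0) \<subseteq> (borel_measurable M :: ('a \<Rightarrow> real) set)"
    using subalgebra_sigma_of by (auto intro: measurable_from_subalg)
  have PQ: "P i \<in> borel_measurable M" "Q i \<in> borel_measurable M"
    using PQ_G_measurable sub by auto
  define p1 where "p1 = a ^ i"
  define q1 where "q1 = q i"
  have P2: "has_bochner_integral M (\<lambda>\<omega>. (P i \<omega> - p1)\<^sup>2) (aa ^ i - p1\<^sup>2)"
    and PQ2: "has_bochner_integral M (\<lambda>\<omega>. 2 * ((P i \<omega> - p1) * (Q i \<omega> - q1))) (2 * (pq i - p1 * q1))"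
    and Q2: "has_bochner_integral M (\<lambda>\<omega>. (Q i \<omega> - q1)\<^sup>2) (qq i - q1\<^sup>2)"
    using moments[of i]
    by (auto simp: has_bochner_integral_iff p1_def[symmetric] q1_def[symmetric] power2_eq_square algebra_simps prob_space)
  \<comment> \<open>The inner conditional mean is known only almost surely, so it is replaced under
    the outer one through a congruence for almost equal integrands.\<close>
  have "AE \<omega> in M. (Y i \<omega> - cond_mean M Y0 (Y i) \<omega>)\<^sup>2
      = ((Y0 \<omega>)\<^sup>2 * (P i \<omega> - p1)\<^sup>2 + Y0 \<omega> * (2 * ((P i \<omega> - p1) * (Q i \<omega> - q1)))) + 1 * (Q i \<omega> - q1)\<^sup>2"
    using cond_mean_Y[of i]
    by eventually_elim (simp add: Y_eq p1_def q1_def power2_eq_square algebra_simps)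
  moreover have "cond_mean M Y0 (Y i) \<in> borel_measurable M"
    unfolding cond_mean_def using subF by auto
  ultimately have "AE \<omega> in M. cond_variance M Y0 (Y i) \<omega> = cond_mean M Y0
      (\<lambda>\<omega>. ((Y0 \<omega>)\<^sup>2 * (P i \<omega> - p1)\<^sup>2 + Y0 \<omega> * (2 * ((P i \<omega> - p1) * (Q i \<omega> - q1)))) + 1 * (Q i \<omega> - q1)\<^sup>2) \<omega>"
    unfolding cond_variance_def cond_mean_def[of _ _ "\<lambda>\<omega>. (_ \<omega>)\<^sup>2"] cond_mean_def[of _ _ "\<lambda>\<omega>. _ \<omega> + _ \<omega>"]
    using PQ Y0(1) by (intro real_cond_exp_cong) (auto simp: Y_eq[abs_def])
  moreover have "AE \<omega> in M. cond_mean M Y0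
      (\<lambda>\<omega>. ((Y0 \<omega>)\<^sup>2 * (P i \<omega> - p1)\<^sup>2 + Y0 \<omega> * (2 * ((P i \<omega> - p1) * (Q i \<omega> - q1)))) + 1 * (Q i \<omega> - q1)\<^sup>2) \<omega>
    = ((Y0 \<omega>)\<^sup>2 * (aa ^ i - p1\<^sup>2) + Y0 \<omega> * (2 * (pq i - p1 * q1))) + 1 * (qq i - q1\<^sup>2)"
  proof (intro cond_mean_add Bochner_Integration.integrable_add cond_mean_indep[OF _ _ _ P2]
      cond_mean_indep[OF _ _ _ PQ2] cond_mean_indep[OF _ _ _ Q2])
  qed (use Y0_sigma_of Y0_integrable Y0(2) PQ_G_measurable[of i] in auto)
  ultimately show ?thesis
    by eventually_elim (simp add: p1_def q1_def algebra_simps)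
qed

lemma has_limit_varianceI:
  assumes "aa < 1"
  shows "has_limit_variance M Y0 Y ((2 * ab * (b / (1 - a)) + bb) / (1 - aa) - (b / (1 - a))\<^sup>2)"
proof -
  \<comment> \<open>A variance is nonnegative; hence \<open>aa < 1\<close> already forces
    \<open>0 \<le> aa\<close> and \<open>\<bar>a\<bar> < 1\<close>.\<close>
  have aa: "a\<^sup>2 \<le> aa"
  proof -
    have "expectation (\<lambda>\<omega>. (A (U 0 \<omega>) (V 0 \<omega>) - a)\<^sup>2) = aa - a\<^sup>2"
      using A_mean[of 0] A_square[of 0]
      by (simp add: has_bochner_integral_iff power2_eq_square algebra_simps prob_space)
    then show ?thesis
      using Bochner_Integration.integral_nonneg[where M = M and f = "\<lambda>\<omega>. (A (U 0 \<omega>) (V 0 \<omega>) - a)\<^sup>2"] by simp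
  qed
  have aa0: "0 \<le> aa" using aa zero_le_power2[of a] by linarith
  have a1: "\<bar>a\<bar> < 1" using aa assms by (simp add: abs_square_less_1[symmetric])
  have q: "q \<longlonglongrightarrow> b / (1 - a)"
    by (rule tendsto_affine_recursion_const[OF _ a1]) simp
  have ai: "(\<lambda>i. a ^ i) \<longlonglongrightarrow> 0" using a1 by (intro LIMSEQ_power_zero) simp
  have aai: "(\<lambda>i. aa ^ i) \<longlonglongrightarrow> 0" using aa0 assms by (intro LIMSEQ_power_zero) simp
  \<comment> \<open>The forcing term \<open>ab * a ^ i\<close> dies out, and with it the covariance
    of slope and shift: the start is forgotten.\<close>
  have "pq \<longlonglongrightarrow> (ab * 0) / (1 - aa)"
    by (rule tendsto_affine_recursion[OF _ aa0 assms tendsto_mult_left[OF ai]]) simp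
  then have pq: "pq \<longlonglongrightarrow> 0" by simp
  have qq: "qq \<longlonglongrightarrow> (2 * ab * (b / (1 - a)) + bb) / (1 - aa)"
    by (rule tendsto_affine_recursion[OF _ aa0 assms
        tendsto_add[OF tendsto_mult_left[OF q, of "2 * ab"] tendsto_const]]) simp
  have "AE \<omega> in M. \<forall>i. cond_variance M Y0 (Y i) \<omega>
     = (aa ^ i - (a ^ i)\<^sup>2) * (Y0 \<omega>)\<^sup>2 + 2 * (pq i - a ^ i * q i) * Y0 \<omega> + (qq i - (q i)\<^sup>2)"
    using cond_variance_Y by (simp add: AE_all_countable)
  then show ?thesis
    unfolding has_limit_variance_def
  proof eventually_elim
    case (elim \<omega>)
    have "(\<lambda>i. (aa ^ i - (a ^ i)\<^sup>2) * (Y0 \<omega>)\<^sup>2 + 2 * (pq i - a ^ i * q i) * Y0 \<omega> + (qq i - (q i)\<^sup>2))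
       \<longlonglongrightarrow> (0 - 0\<^sup>2) * (Y0 \<omega>)\<^sup>2 + 2 * (0 - 0 * (b / (1 - a))) * Y0 \<omega>
         + ((2 * ab * (b / (1 - a)) + bb) / (1 - aa) - (b / (1 - a))\<^sup>2)"
      by (intro tendsto_intros ai aai pq q qq)
    with elim show ?case by simp
  qed
qed

end

text \<open>The conclusions of the locale as rules with premises, so that a scheme only has to
  supply its two maps and their five moments.\<close>

lemma (in independent_noise) affine_recursion_limits:
  fixes A B :: "real \<Rightarrow> real \<Rightarrow> real"
  assumes "case_prod A \<in> borel_measurable (borel \<Otimes>\<^sub>M borel)" "case_prod B \<in> borel_measurable (borel \<Otimes>\<^sub>M borel)"
    and "\<And>i. has_bochner_integral M (\<lambda>\<omega>. A (U i \<omega>) (V i \<omega>)) a"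
    and "\<And>i. has_bochner_integral M (\<lambda>\<omega>. (A (U i \<omega>) (V i \<omega>))\<^sup>2) aa"
    and "\<And>i. has_bochner_integral M (\<lambda>\<omega>. B (U i \<omega>) (V i \<omega>)) b"
    and "\<And>i. has_bochner_integral M (\<lambda>\<omega>. A (U i \<omega>) (V i \<omega>) * B (U i \<omega>) (V i \<omega>)) ab"
    and "\<And>i. has_bochner_integral M (\<lambda>\<omega>. (B (U i \<omega>) (V i \<omega>))\<^sup>2) bb"
    and "\<And>\<omega>. Y 0 \<omega> = Y0 \<omega>"
    and "\<And>i \<omega>. Y (Suc i) \<omega> = A (U i \<omega>) (V i \<omega>) * Y i \<omega> + B (U i \<omega>) (V i \<omega>)"
  shows "\<bar>a\<bar> < 1 \<Longrightarrow> has_limit_mean M Y0 Y (b / (1 - a))"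
    and "aa < 1 \<Longrightarrow> has_limit_variance M Y0 Y ((2 * ab * (b / (1 - a)) + bb) / (1 - aa) - (b / (1 - a))\<^sup>2)"
proof -
  interpret random_affine_recursion M G Y0 U V A B Y a aa b ab bb
    by unfold_locales (fact assms)+
  show "\<bar>a\<bar> < 1 \<Longrightarrow> has_limit_mean M Y0 Y (b / (1 - a))"
    by (rule has_limit_meanI)
  show "aa < 1 \<Longrightarrow> has_limit_variance M Y0 Y ((2 * ab * (b / (1 - a)) + bb) / (1 - aa) - (b / (1 - a))\<^sup>2)"
    by (rule has_limit_varianceI)
qed

text \<open>Here \<open>Y + k\<^sub>1\<close> follows an affine recursion with the same factor and the deterministic shift
  \<open>k\<^sub>1 + k\<^sub>2\<close>, which explains the form of the variance.\<close>

lemma (in independent_noise) proportional_shift_limits: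
  fixes A :: "real \<Rightarrow> real" and k1 k2 :: real
  assumes A: "A \<in> borel_measurable borel"
    and mean: "\<And>i. has_bochner_integral M (\<lambda>\<omega>. A (U i \<omega>)) a"
    and square: "\<And>i. has_bochner_integral M (\<lambda>\<omega>. (A (U i \<omega>))\<^sup>2) aa"
    and Y: "\<And>\<omega>. Y 0 \<omega> = Y0 \<omega>" "\<And>i \<omega>. Y (Suc i) \<omega> = A (U i \<omega>) * (Y i \<omega> + k1) + k2"
    and "\<bar>a\<bar> < 1"
  shows "has_limit_mean M Y0 Y ((k1 * a + k2) / (1 - a))"
    and "aa < 1 \<Longrightarrow> has_limit_variance M Y0 Y (((k1 + k2) / (1 - a))\<^sup>2 * ((aa - a\<^sup>2) / (1 - aa)))"
proof -
  have k: "has_bochner_integral M (\<lambda>\<omega>. k) k" for k :: real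
    by (simp add: has_bochner_integral_iff prob_space)
  note [measurable] = A
  have A_meas: "case_prod (\<lambda>x y. A x) \<in> borel_measurable (borel \<Otimes>\<^sub>M borel)"
    and B_meas: "case_prod (\<lambda>x y. k1 * A x + k2) \<in> borel_measurable (borel \<Otimes>\<^sub>M borel)"
    by measurable
  have b: "has_bochner_integral M (\<lambda>\<omega>. k1 * A (U i \<omega>) + k2) (k1 * a + k2)" for i
    by (intro has_bochner_integral_add has_bochner_integral_mult_right mean k)
  have "has_bochner_integral M (\<lambda>\<omega>. k1 * (A (U i \<omega>))\<^sup>2 + k2 * A (U i \<omega>)) (k1 * aa + k2 * a)" for i
    by (intro has_bochner_integral_add has_bochner_integral_mult_right mean square)
  then have ab: "has_bochner_integral M (\<lambda>\<omega>. A (U i \<omega>) * (k1 * A (U i \<omega>) + k2)) (k1 * aa + k2 * a)" for i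
    by (simp add: power2_eq_square algebra_simps)
  have "has_bochner_integral M (\<lambda>\<omega>. k1\<^sup>2 * (A (U i \<omega>))\<^sup>2 + (2 * k1 * k2) * A (U i \<omega>) + k2\<^sup>2)
      (k1\<^sup>2 * aa + (2 * k1 * k2) * a + k2\<^sup>2)" for i
    by (intro has_bochner_integral_add has_bochner_integral_mult_right mean square k)
  then have bb: "has_bochner_integral M (\<lambda>\<omega>. (k1 * A (U i \<omega>) + k2)\<^sup>2)
      (k1\<^sup>2 * aa + (2 * k1 * k2) * a + k2\<^sup>2)" for i
    by (simp add: power2_eq_square algebra_simps)
  note limits = affine_recursion_limits[where Y = Y and A = "\<lambda>x y. A x" and B = "\<lambda>x y. k1 * A x + k2", OF A_meas B_meas mean square b ab bb Y(1)]
  have rec: "Y (Suc i) \<omega> = A (U i \<omega>) * Y i \<omega> + (k1 * A (U i \<omega>) + k2)" for i \<omega>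
    by (simp add: Y algebra_simps)
  show "has_limit_mean M Y0 Y ((k1 * a + k2) / (1 - a))"
    by (rule limits(1)[OF rec \<open>\<bar>a\<bar> < 1\<close>])
  assume "aa < 1"
  \<comment> \<open>The limit mean replaces \<open>k2\<close> as a parameter, which turns the claim
    into a rational identity in \<open>m\<close>, \<open>k1\<close>, \<open>a\<close> and
    \<open>aa\<close>; \<open>m + k1\<close> is the limit mean of \<open>Y + k1\<close>.\<close>
  define m where "m = (k1 * a + k2) / (1 - a)"
  have "1 - a \<noteq> 0" using \<open>\<bar>a\<bar> < 1\<close> by auto
  then have k2: "k2 = m * (1 - a) - k1 * a" and mz: "(k1 + k2) / (1 - a) = m + k1"
    by (simp_all add: m_def field_simps)
  have "(2 * (k1 * aa + k2 * a) * m + (k1\<^sup>2 * aa + (2 * k1 * k2) * a + k2\<^sup>2)) / (1 - aa) - m\<^sup>2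
      = (m + k1)\<^sup>2 * ((aa - a\<^sup>2) / (1 - aa))"
    using \<open>aa < 1\<close> unfolding k2 by (simp add: field_simps power2_eq_square)
  then show "has_limit_variance M Y0 Y (((k1 + k2) / (1 - a))\<^sup>2 * ((aa - a\<^sup>2) / (1 - aa)))"
    using limits(2)[OF rec \<open>aa < 1\<close>] unfolding mz m_def[symmetric] by simp
qed

section \<open>Gaussian moments of exponentials and their divided differences\<close>

lemma (in prob_space) distributed_has_bochner_integral:
  fixes X :: "'a \<Rightarrow> real" and f g :: "real \<Rightarrow> real"
  assumes "distributed M lborel X f" "g \<in> borel_measurable borel" "\<And>x. 0 \<le> f x"
    and "has_bochner_integral lborel (\<lambda>x. f x * g x) v"
  shows "has_bochner_integral M (\<lambda>\<omega>. g (X \<omega>)) v"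
  using assms distributed_integrable[of M lborel X f g] distributed_integral[of M lborel X f g]
  by (simp add: has_bochner_integral_iff)

text \<open>Order four is needed because the Milstein factor and the log-ODE correction are
  quadratic in a Gaussian and get squared.\<close>

lemma (in prob_space) normal_moments:
  assumes "distributed M lborel X (normal_density 0 s)" "s > 0"
  shows "has_bochner_integral M X 0" "has_bochner_integral M (\<lambda>\<omega>. (X \<omega>)\<^sup>2) (s\<^sup>2)"
    "has_bochner_integral M (\<lambda>\<omega>. (X \<omega>) ^ 3) 0" "has_bochner_integral M (\<lambda>\<omega>. (X \<omega>) ^ 4) (3 * s ^ 4)"
proof -
  show "has_bochner_integral M X 0"
    using normal_moment_odd[OF assms(2), of 0 0]
    by (intro distributed_has_bochner_integral[OF assms(1), of "\<lambda>x. x"]) simp_all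
  show "has_bochner_integral M (\<lambda>\<omega>. (X \<omega>)\<^sup>2) (s\<^sup>2)"
    using normal_moment_even[OF assms(2), of 0 1]
    by (intro distributed_has_bochner_integral[OF assms(1), of "\<lambda>x. x\<^sup>2"]) simp_all
  show "has_bochner_integral M (\<lambda>\<omega>. (X \<omega>) ^ 3) 0"
    using normal_moment_odd[OF assms(2), of 0 1]
    by (intro distributed_has_bochner_integral[OF assms(1), of "\<lambda>x. x ^ 3"]) (simp_all add: numeral_3_eq_3)
  have "fact 4 / ((2 / s\<^sup>2)\<^sup>2 * fact 2) = 3 * s ^ 4"
    using assms(2) by (simp add: fact_numeral field_simps)
  then show "has_bochner_integral M (\<lambda>\<omega>. (X \<omega>) ^ 4) (3 * s ^ 4)"
    using normal_moment_even[OF assms(2), of 0 2]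
    by (intro distributed_has_bochner_integral[OF assms(1), of "\<lambda>x. x ^ 4"]) simp_all
qed

text \<open>Completing the square: tilting the density by \<open>exp (t * x)\<close> moves its mean
  to \<open>t * s^2\<close> and produces the constant.\<close>

lemma (in prob_space) normal_exp_moment:
  assumes X: "distributed M lborel X (normal_density 0 s)" and s: "s > 0"
  shows "has_bochner_integral M (\<lambda>\<omega>. exp (t * X \<omega>)) (exp (t\<^sup>2 * s\<^sup>2 / 2))"
proof (rule distributed_has_bochner_integral[OF X, of "\<lambda>x. exp (t * x)"])
  have "normal_density 0 s x * exp (t * x) = exp (t\<^sup>2 * s\<^sup>2 / 2) * normal_density (t * s\<^sup>2) s x" for x
  proof -
    have "- x\<^sup>2 / (2 * s\<^sup>2) + t * x = t\<^sup>2 * s\<^sup>2 / 2 + - (x - t * s\<^sup>2)\<^sup>2 / (2 * s\<^sup>2)"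
      using s by (simp add: field_simps power2_eq_square)
    then show ?thesis
      unfolding normal_density_def by (simp add: exp_add[symmetric])
  qed
  moreover have "has_bochner_integral lborel (normal_density (t * s\<^sup>2) s) 1"
    using integrable_normal_density[OF s] integral_normal_density[OF s] by (simp add: has_bochner_integral_iff)
  from has_bochner_integral_mult_right[OF this, of "exp (t\<^sup>2 * s\<^sup>2 / 2)"]
  have "has_bochner_integral lborel (\<lambda>x. exp (t\<^sup>2 * s\<^sup>2 / 2) * normal_density (t * s\<^sup>2) s x) (exp (t\<^sup>2 * s\<^sup>2 / 2))"
    by simp
  ultimately show "has_bochner_integral lborel (\<lambda>x. normal_density 0 s x * exp (t * x)) (exp (t\<^sup>2 * s\<^sup>2 / 2))"
    by simp
qed simp_all

text \<open>A law with a Lebesgue density has no atoms; this keeps denominators nonzero almost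
  surely.\<close>

lemma (in prob_space) distributed_lborel_AE_neq:
  fixes X :: "'a \<Rightarrow> real"
  assumes "distributed M lborel X f"
  shows "AE \<omega> in M. X \<omega> \<noteq> c"
proof -
  have X: "X \<in> M \<rightarrow>\<^sub>M lborel" and f: "f \<in> borel_measurable lborel" and d: "distr M lborel X = density lborel f"
    using assms by (auto simp: distributed_def)
  have "AE x in lborel. x \<noteq> c"
    by (rule AE_lborel_singleton)
  then have "AE x in distr M lborel X. x \<noteq> c"
    unfolding d using f by (subst AE_density) auto
  then show ?thesis
    using X by (subst (asm) AE_distr_iff) auto
qed

text \<open>Tonelli's theorem with both inner integrals evaluated by the fundamental theorem of
  calculus: the expectation of \<open>\<integral>\<^sub>p\<^sup>q k(w) e\<^sup>w\<^sup>Z dw\<close>.\<close>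

lemma (in prob_space) expectation_exp_primitive:
  fixes Z :: "'a \<Rightarrow> real" and H :: "real \<Rightarrow> real \<Rightarrow> real"
  assumes Z: "Z \<in> borel_measurable M" and "p \<le> q"
    and k: "k \<in> borel_measurable borel" "\<And>w. w \<in> {p..q} \<Longrightarrow> 0 \<le> k w"
    and g: "g \<in> borel_measurable borel" "\<And>w. has_bochner_integral M (\<lambda>\<omega>. exp (w * Z \<omega>)) (g w)"
    and H: "AE \<omega> in M. \<forall>w\<in>{p..q}. (H (Z \<omega>) has_real_derivative k w * exp (w * Z \<omega>)) (at w)"
    and H_meas: "(\<lambda>\<omega>. H (Z \<omega>) q - H (Z \<omega>) p) \<in> borel_measurable M"
    and F: "\<And>w. w \<in> {p..q} \<Longrightarrow> (F has_real_derivative k w * g w) (at w)"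
  shows "has_bochner_integral M (\<lambda>\<omega>. H (Z \<omega>) q - H (Z \<omega>) p) (F q - F p)"
proof -
  interpret pair_sigma_finite M lborel ..
  note [measurable] = Z k(1) g(1)
  have g0: "0 \<le> g w" for w
    using g(2)[of w] Bochner_Integration.integral_nonneg[of M "\<lambda>\<omega>. exp (w * Z \<omega>)"] by (simp add: has_bochner_integral_iff)
  have H_eq: "AE \<omega> in M. (\<integral>\<^sup>+w. ennreal (k w * exp (w * Z \<omega>)) * indicator {p..q} w \<partial>lborel)
      = ennreal (H (Z \<omega>) q - H (Z \<omega>) p) \<and> H (Z \<omega>) p \<le> H (Z \<omega>) q"
    using H
  proof eventually_elim
    case (elim \<omega>)
    have "H (Z \<omega>) p \<le> H (Z \<omega>) q"
      using elim k(2) by (intro DERIV_nonneg_imp_nondecreasing[OF \<open>p \<le> q\<close>]) (metis atLeastAtMost_iff exp_ge_zero mult_nonneg_nonneg)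
    then show ?case
      using elim k(2) \<open>p \<le> q\<close>
      by (auto intro!: nn_integral_FTC_Icc)
  qed
  have F_eq: "(\<integral>\<^sup>+w. ennreal (k w * g w) * indicator {p..q} w \<partial>lborel) = ennreal (F q - F p)"
    using F k(2) g0 \<open>p \<le> q\<close> by (intro nn_integral_FTC_Icc) auto
  have F0: "F p \<le> F q"
    using F k(2) g0 by (intro DERIV_nonneg_imp_nondecreasing[OF \<open>p \<le> q\<close>]) (metis atLeastAtMost_iff mult_nonneg_nonneg)
  show ?thesis
  \<comment> \<open>For a nonnegative function the value of the nonnegative integral gives both
    integrability and expectation.\<close>
  proof (rule has_bochner_integral_nn_integral[OF H_meas])
    show "AE \<omega> in M. 0 \<le> H (Z \<omega>) q - H (Z \<omega>) p"
      using H_eq by eventually_elim simp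
    show "0 \<le> F q - F p" using F0 by simp
    have "(\<integral>\<^sup>+\<omega>. ennreal (H (Z \<omega>) q - H (Z \<omega>) p) \<partial>M)
        = (\<integral>\<^sup>+\<omega>. (\<integral>\<^sup>+w. ennreal (k w * exp (w * Z \<omega>)) * indicator {p..q} w \<partial>lborel) \<partial>M)"
      using H_eq by (intro nn_integral_cong_AE) auto
    also have "\<dots> = (\<integral>\<^sup>+w. (\<integral>\<^sup>+\<omega>. ennreal (k w * exp (w * Z \<omega>)) * indicator {p..q} w \<partial>M) \<partial>lborel)"
      by (rule Fubini'[symmetric]) measurable
    also have "\<dots> = (\<integral>\<^sup>+w. ennreal (k w * g w) * indicator {p..q} w \<partial>lborel)"
    proof (rule nn_integral_cong)
      fix w
      have E: "(\<integral>\<^sup>+\<omega>. ennreal (exp (w * Z \<omega>)) \<partial>M) = ennreal (g w)"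
        using g(2)[of w] by (simp add: has_bochner_integral_iff nn_integral_eq_integral)
      show "(\<integral>\<^sup>+\<omega>. ennreal (k w * exp (w * Z \<omega>)) * indicator {p..q} w \<partial>M) = ennreal (k w * g w) * indicator {p..q} w"
      proof (cases "w \<in> {p..q}")
        case True
        then show ?thesis
          using k(2)[of w] g0 E by (simp add: ennreal_mult nn_integral_cmult)
      qed simp
    qed
    also note F_eq
    finally show "(\<integral>\<^sup>+\<omega>. ennreal (H (Z \<omega>) q - H (Z \<omega>) p) \<partial>M) = ennreal (F q - F p)" .
  qed
qed

section \<open>The imaginary error function and primitives of the moment generating function\<close>

lemma erfi_has_real_derivative: "(erfi has_real_derivative 2 / sqrt pi * exp (x\<^sup>2)) (at x)"
proof -
  \<comment> \<open>The fundamental theorem gives a derivative within a compact interval; this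
    radius puts \<open>x\<close> into its interior.\<close>
  define r where "r = \<bar>x\<bar> + 1"
  let ?I = "\<lambda>c x. LBINT u=ereal c..ereal x. exp (u\<^sup>2) :: real"
  have "(?I 0 has_vector_derivative exp (x\<^sup>2)) (at x within {-r..r})"
    unfolding r_def by (rule interval_integral_FTC2) (auto intro!: continuous_intros)
  moreover have "at x within {-r..r} = at x"
    by (rule at_within_interior) (auto simp: r_def)
  ultimately have "(?I 0 has_real_derivative exp (x\<^sup>2)) (at x)"
    by (simp add: has_real_derivative_iff_has_vector_derivative)
  from DERIV_cmult[OF this, of "2 / sqrt pi"] show ?thesis
    by (simp add: erfi_def[abs_def] zero_ereal_def)
qed

lemma erfi_minus: "erfi (- x) = - erfi x"
proof -
  have D: "((\<lambda>x. erfi (- x) + erfi x) has_real_derivative 0) (at x)" for x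
    by (rule derivative_eq_intros DERIV_chain2[OF erfi_has_real_derivative] erfi_has_real_derivative refl | simp)+
  have "erfi (- x) + erfi x = erfi (- 0) + erfi 0"
    using DERIV_isconst_all[of "\<lambda>x. erfi (- x) + erfi x" x 0] D by simp
  then show ?thesis by (simp add: erfi_def zero_ereal_def)
qed

text \<open>The moment generating function E e^(wZ) of Z = -a \<Delta> + \<sigma> \<xi> with \<xi>
  of law N(0, \<Delta>); \<open>gbm_factor\<close> is e^Z.\<close>

definition gbm_mgf :: "real \<Rightarrow> real \<Rightarrow> real \<Rightarrow> real \<Rightarrow> real" where
  "gbm_mgf \<tau> \<sigma> \<Delta> w = exp (- drift_a \<tau> \<sigma> * \<Delta> * w + \<sigma>\<^sup>2 * \<Delta> * w\<^sup>2 / 2)"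

text \<open>Found by completing the square in w: the exponent of \<open>gbm_mgf\<close> is
  (\<sigma>^2 w - a)^2 \<Delta> / (2 \<sigma>^2) minus the constant a^2 \<Delta> / (2 \<sigma>^2).
  The root prefactor cancels the inner derivative and the normalisation of
  \<open>erfi\<close>.\<close>

definition gbm_mgf_primitive :: "real \<Rightarrow> real \<Rightarrow> real \<Rightarrow> real \<Rightarrow> real" where
  "gbm_mgf_primitive \<tau> \<sigma> \<Delta> w =
     sqrt pi / (\<sigma> * sqrt (2 * \<Delta>)) * exp (- ((drift_a \<tau> \<sigma>)\<^sup>2) * \<Delta> / (2 * \<sigma>\<^sup>2))
     * erfi ((\<sigma>\<^sup>2 * w - drift_a \<tau> \<sigma>) * sqrt \<Delta> / (\<sigma> * sqrt 2))"

lemma gbm_mgf_primitive_has_derivative: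
  assumes "\<sigma> > 0" "\<Delta> > 0"
  shows "(gbm_mgf_primitive \<tau> \<sigma> \<Delta> has_real_derivative gbm_mgf \<tau> \<sigma> \<Delta> w) (at w)"
proof -
  let ?a = "drift_a \<tau> \<sigma>"
  let ?s = "\<lambda>w. (\<sigma>\<^sup>2 * w - ?a) * sqrt \<Delta> / (\<sigma> * sqrt 2)"
  let ?C = "sqrt pi / (\<sigma> * sqrt (2 * \<Delta>)) * exp (- (?a\<^sup>2) * \<Delta> / (2 * \<sigma>\<^sup>2))"
  have s: "(?s has_real_derivative \<sigma> * sqrt \<Delta> / sqrt 2) (at w)"
    using assms by (auto intro!: derivative_eq_intros simp: power2_eq_square field_simps)
  have "((\<lambda>w. ?C * erfi (?s w)) has_real_derivative
      ?C * (2 / sqrt pi * exp ((?s w)\<^sup>2) * (\<sigma> * sqrt \<Delta> / sqrt 2))) (at w)"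
    by (intro DERIV_cmult DERIV_chain2[OF erfi_has_real_derivative s])
  moreover have "?C * (2 / sqrt pi * exp ((?s w)\<^sup>2) * (\<sigma> * sqrt \<Delta> / sqrt 2)) = gbm_mgf \<tau> \<sigma> \<Delta> w"
  proof -
    have "(?s w)\<^sup>2 = (\<sigma>\<^sup>2 * w - ?a)\<^sup>2 * \<Delta> / (2 * \<sigma>\<^sup>2)"
      using assms by (simp add: power_mult_distrib power_divide)
    moreover have "- (?a\<^sup>2) * \<Delta> / (2 * \<sigma>\<^sup>2) + (\<sigma>\<^sup>2 * w - ?a)\<^sup>2 * \<Delta> / (2 * \<sigma>\<^sup>2)
        = - ?a * \<Delta> * w + \<sigma>\<^sup>2 * \<Delta> * w\<^sup>2 / 2"
      using assms by (simp add: field_simps power2_eq_square)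
    ultimately have e: "- (?a\<^sup>2) * \<Delta> / (2 * \<sigma>\<^sup>2) + (?s w)\<^sup>2 = - ?a * \<Delta> * w + \<sigma>\<^sup>2 * \<Delta> * w\<^sup>2 / 2"
      by simp
    have c: "sqrt pi / (\<sigma> * sqrt (2 * \<Delta>)) * (2 / sqrt pi * (\<sigma> * sqrt \<Delta> / sqrt 2)) = 1"
      using assms by (simp add: real_sqrt_mult field_simps)
    have "?C * (2 / sqrt pi * exp ((?s w)\<^sup>2) * (\<sigma> * sqrt \<Delta> / sqrt 2))
      = sqrt pi / (\<sigma> * sqrt (2 * \<Delta>)) * (2 / sqrt pi * (\<sigma> * sqrt \<Delta> / sqrt 2))
        * exp (- (?a\<^sup>2) * \<Delta> / (2 * \<sigma>\<^sup>2) + (?s w)\<^sup>2)"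
      unfolding exp_add by simp
    then show ?thesis unfolding c e gbm_mgf_def by simp
  qed
  ultimately show ?thesis
    unfolding gbm_mgf_primitive_def[abs_def] by simp
qed

lemma gbm_mgf_has_derivative:
  "(gbm_mgf \<tau> \<sigma> \<Delta> has_real_derivative
     (\<sigma>\<^sup>2 * \<Delta> * w - drift_a \<tau> \<sigma> * \<Delta>) * gbm_mgf \<tau> \<sigma> \<Delta> w) (at w)"
  unfolding gbm_mgf_def[abs_def] by (auto intro!: derivative_eq_intros)

text \<open>Solving \<open>g' = (\<sigma>\<^sup>2 \<Delta> w - a \<Delta>) g\<close> for \<open>w g\<close> gives a primitive of the first moment.\<close>

lemma gbm_mgf_moment_primitive_has_derivative:
  assumes "\<sigma> > 0" "\<Delta> > 0"
  shows "((\<lambda>w. (gbm_mgf \<tau> \<sigma> \<Delta> w / \<Delta> + drift_a \<tau> \<sigma> * gbm_mgf_primitive \<tau> \<sigma> \<Delta> w) / \<sigma>\<^sup>2)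
    has_real_derivative w * gbm_mgf \<tau> \<sigma> \<Delta> w) (at w)"
  using assms
  by (auto intro!: derivative_eq_intros gbm_mgf_has_derivative gbm_mgf_primitive_has_derivative
      simp: field_simps power2_eq_square)

lemma erfi_uminus_scaled: "erfi (- x * s / c) = - erfi (x * s / c)"
  by (simp add: erfi_minus[symmetric])

section \<open>The explicit constants as integrals of the moment generating function\<close>

text \<open>The endpoint 0 contributes the first \<open>erfi\<close> of \<open>L_const\<close>, by
  oddness, and the endpoint 1 the second.\<close>

lemma gbm_mgf_primitive_diff_0_1:
  assumes "\<sigma> > 0" "\<Delta> > 0"
  shows "gbm_mgf_primitive \<tau> \<sigma> \<Delta> 1 - gbm_mgf_primitive \<tau> \<sigma> \<Delta> 0 = L_const \<tau> \<sigma> \<Delta>"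
proof -
  have "erfi ((\<sigma>\<^sup>2 * 0 - drift_a \<tau> \<sigma>) * sqrt \<Delta> / (\<sigma> * sqrt 2))
      = - erfi ((1 / \<tau> + \<sigma>\<^sup>2 / 2) * sqrt \<Delta> / (\<sigma> * sqrt 2))"
    unfolding erfi_uminus_scaled[symmetric] by (simp add: drift_a_def)
  moreover have "\<sigma>\<^sup>2 * 1 - drift_a \<tau> \<sigma> = - 1 / \<tau> + \<sigma>\<^sup>2 / 2"
    by (simp add: drift_a_def)
  ultimately show ?thesis
    unfolding gbm_mgf_primitive_def L_const_def
    by (simp only: right_diff_distrib[symmetric] diff_minus_eq_add drift_a_def add.commute)
qed

text \<open>The exponential factor stems from a^2 = (1/\<tau> - \<sigma>^2/2)^2 + 2
  \<sigma>^2/\<tau>. In terms of probability, weighting with e^Z, whose mean is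
  e^(-\<Delta>/\<tau>), shifts the mean of Z by \<sigma>^2 \<Delta>, and \<open>L_tilde\<close> is
  the mean of alpha after this shift.\<close>

lemma gbm_mgf_primitive_diff_1_2:
  assumes "\<tau> > 0" "\<sigma> > 0" "\<Delta> > 0"
  shows "gbm_mgf_primitive \<tau> \<sigma> \<Delta> 2 - gbm_mgf_primitive \<tau> \<sigma> \<Delta> 1 = exp (- \<Delta> / \<tau>) * L_tilde \<tau> \<sigma> \<Delta>"
proof -
  have 1: "erfi ((\<sigma>\<^sup>2 * 1 - drift_a \<tau> \<sigma>) * sqrt \<Delta> / (\<sigma> * sqrt 2))
      = - erfi ((1 / \<tau> - \<sigma>\<^sup>2 / 2) * sqrt \<Delta> / (\<sigma> * sqrt 2))"
    unfolding erfi_uminus_scaled[symmetric] by (simp add: drift_a_def)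
  have 2: "\<sigma>\<^sup>2 * 2 - drift_a \<tau> \<sigma> = - 1 / \<tau> + 3 * \<sigma>\<^sup>2 / 2"
    by (simp add: drift_a_def)
  have "- ((drift_a \<tau> \<sigma>)\<^sup>2) * \<Delta> / (2 * \<sigma>\<^sup>2) = - \<Delta> / \<tau> + - ((1 / \<tau> - \<sigma>\<^sup>2 / 2)\<^sup>2) * \<Delta> / (2 * \<sigma>\<^sup>2)"
    using assms by (simp add: drift_a_def field_simps power2_eq_square)
  then have 3: "exp (- ((drift_a \<tau> \<sigma>)\<^sup>2) * \<Delta> / (2 * \<sigma>\<^sup>2))
      = exp (- \<Delta> / \<tau>) * exp (- ((1 / \<tau> - \<sigma>\<^sup>2 / 2)\<^sup>2) * \<Delta> / (2 * \<sigma>\<^sup>2))"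
    by (simp only: exp_add)
  show ?thesis
    unfolding gbm_mgf_primitive_def L_tilde_def 1 2 3 by (simp add: algebra_simps)
qed

text \<open>The right side is the integral of \<open>g\<close> against min(w, 2 - w) over [0, 2],
  evaluated by the primitives of \<open>g\<close> and \<open>w * g\<close>; the second difference of
  \<open>g\<close> collects the boundary terms. The three \<open>erfi\<close> values in
  \<open>L_bar\<close> belong to the endpoints 0, 2 and 1, in this order.\<close>

lemma L_bar_eq:
  assumes "\<tau> > 0" "\<sigma> > 0" "\<Delta> > 0"
  defines "g \<equiv> gbm_mgf \<tau> \<sigma> \<Delta>" and "h \<equiv> gbm_mgf_primitive \<tau> \<sigma> \<Delta>" and "a \<equiv> drift_a \<tau> \<sigma>"
  shows "L_bar \<tau> \<sigma> \<Delta> = (2 * g 1 - g 0 - g 2) / (\<sigma>\<^sup>2 * \<Delta>)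
    + a / \<sigma>\<^sup>2 * (h 1 - h 0) + (2 - a / \<sigma>\<^sup>2) * (h 2 - h 1)"
proof -
  let ?e = "\<lambda>x. erfi (x * sqrt \<Delta> / (\<sigma> * sqrt 2))"
  let ?E = "exp (- (a\<^sup>2) * \<Delta> / (2 * \<sigma>\<^sup>2))"
  have G: "g 0 = 1" "g 1 = exp (- a * \<Delta> + \<sigma>\<^sup>2 / 2 * \<Delta>)" "g 2 = exp (- 2 * a * \<Delta> + 2 * \<sigma>\<^sup>2 * \<Delta>)"
    by (simp_all add: g_def gbm_mgf_def a_def algebra_simps)
  \<comment> \<open>The bracket 1/(\<tau> \<sigma>^2) + 1/2 equals a/\<sigma>^2, so its contribution
    cancels the outer exponential.\<close>
  have "- (a\<^sup>2) * \<Delta> / (2 * \<sigma>\<^sup>2) + a * \<Delta> / 2 * (- 4 + (1 / (\<tau> * \<sigma>\<^sup>2) + 1 / 2)) = - 2 * a * \<Delta>"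
    using assms(1-3) by (simp add: a_def drift_a_def field_simps power2_eq_square)
  then have e1: "?E * exp (a * \<Delta> / 2 * (- 4 + (1 / (\<tau> * \<sigma>\<^sup>2) + 1 / 2))) = exp (- 2 * a * \<Delta>)"
    by (simp only: exp_add[symmetric])
  have e2: "exp (- 2 * a * \<Delta>) * (exp (2 * a * \<Delta>) + exp (2 * \<sigma>\<^sup>2 * \<Delta>) - 2 * exp (a * \<Delta> + \<sigma>\<^sup>2 / 2 * \<Delta>))
      = g 0 + g 2 - 2 * g 1"
    unfolding G by (simp add: algebra_simps exp_add[symmetric])
  let ?c = "sqrt pi / (\<sigma> * sqrt (2 * \<Delta>)) * ?E"
  have h0: "h 0 = - (?c * ?e (1 / \<tau> + \<sigma>\<^sup>2 / 2))"
    and h1: "h 1 = - (?c * ?e (1 / \<tau> - \<sigma>\<^sup>2 / 2))"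
    and h2: "h 2 = - (?c * ?e (1 / \<tau> - 3 * \<sigma>\<^sup>2 / 2))"
    unfolding h_def gbm_mgf_primitive_def mult_minus_right[symmetric] erfi_uminus_scaled[symmetric]
    by (simp_all add: drift_a_def a_def)
  have c: "1 / (2 * \<sigma> ^ 3 * \<Delta>) * ?E * sqrt (2 * pi * \<Delta>) = ?c / \<sigma>\<^sup>2"
  proof -
    have "sqrt (2 * pi * \<Delta>) * sqrt (2 * \<Delta>) = sqrt pi * (sqrt (2 * \<Delta>) * sqrt (2 * \<Delta>))"
      by (simp add: real_sqrt_mult)
    also have "\<dots> = sqrt pi * (2 * \<Delta>)"
      using assms(3) by simp
    finally show ?thesis
      using assms(2,3) by (simp add: field_simps power2_eq_square power3_eq_cube)
  qed
  have "L_bar \<tau> \<sigma> \<Delta> = - (?E * exp (a * \<Delta> / 2 * (- 4 + (1 / (\<tau> * \<sigma>\<^sup>2) + 1 / 2)))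
      * (exp (2 * a * \<Delta>) + exp (2 * \<sigma>\<^sup>2 * \<Delta>) - 2 * exp (a * \<Delta> + \<sigma>\<^sup>2 / 2 * \<Delta>))) / (\<sigma>\<^sup>2 * \<Delta>)
    + (1 / (2 * \<sigma> ^ 3 * \<Delta>) * ?E * sqrt (2 * pi * \<Delta>))
      * (?e (1 / \<tau> + \<sigma>\<^sup>2 / 2) * a + ?e (1 / \<tau> - 3 * \<sigma>\<^sup>2 / 2) * (a - 2 * \<sigma>\<^sup>2)
         + ?e (1 / \<tau> - \<sigma>\<^sup>2 / 2) * 2 * (- 1 / \<tau> + \<sigma>\<^sup>2 / 2))"
    unfolding L_bar_def Let_def a_def[symmetric] distrib_left[of "1 / (2 * \<sigma> ^ 3 * \<Delta>) * ?E"]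
    using assms(2,3)
    by (intro arg_cong2[where f = "(+)"]) (simp_all add: power2_eq_square power3_eq_cube mult.assoc)
  also have "\<dots> = - (g 0 + g 2 - 2 * g 1) / (\<sigma>\<^sup>2 * \<Delta>) + (- h 0 * a - h 2 * (a - 2 * \<sigma>\<^sup>2) - h 1 * 2 * (- 1 / \<tau> + \<sigma>\<^sup>2 / 2)) / \<sigma>\<^sup>2"
    unfolding e1 e2 c h0 h1 h2 by (simp add: algebra_simps add_divide_distrib diff_divide_distrib)
  also have "- 1 / \<tau> + \<sigma>\<^sup>2 / 2 = \<sigma>\<^sup>2 - a"
    by (simp add: a_def drift_a_def)
  also have "- (g 0 + g 2 - 2 * g 1) / (\<sigma>\<^sup>2 * \<Delta>) + (- h 0 * a - h 2 * (a - 2 * \<sigma>\<^sup>2) - h 1 * 2 * (\<sigma>\<^sup>2 - a)) / \<sigma>\<^sup>2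
      = (2 * g 1 - g 0 - g 2) / (\<sigma>\<^sup>2 * \<Delta>) + a / \<sigma>\<^sup>2 * (h 1 - h 0) + (2 - a / \<sigma>\<^sup>2) * (h 2 - h 1)"
    using assms(2,3) by (simp add: field_simps)
  finally show ?thesis .
qed

section \<open>Moments of the divided difference (e^Z - 1) / Z\<close>

text \<open>Differences of e^(wZ)/Z between w = 0 and 1 give alpha, between 1 and 2 they give e^Z
  alpha. The primitives in w divide by Z and thus hold only almost surely; the conventional value of
  \<open>lin_factor\<close> at Z = 0 does not affect the moments.\<close>

lemma (in prob_space) lin_factor_moments:
  assumes X: "distributed M lborel X (normal_density 0 (sqrt \<Delta>))" and pos: "\<tau> > 0" "\<sigma> > 0" "\<Delta> > 0"
  shows "has_bochner_integral M (\<lambda>\<omega>. lin_factor \<tau> \<sigma> \<Delta> (X \<omega>)) (L_const \<tau> \<sigma> \<Delta>)"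
    and "has_bochner_integral M (\<lambda>\<omega>. gbm_factor \<tau> \<sigma> \<Delta> (X \<omega>) * lin_factor \<tau> \<sigma> \<Delta> (X \<omega>))
      (exp (- \<Delta> / \<tau>) * L_tilde \<tau> \<sigma> \<Delta>)"
    and "has_bochner_integral M (\<lambda>\<omega>. (lin_factor \<tau> \<sigma> \<Delta> (X \<omega>))\<^sup>2) (L_bar \<tau> \<sigma> \<Delta>)"
proof -
  define a where "a = drift_a \<tau> \<sigma>"
  define g where "g = gbm_mgf \<tau> \<sigma> \<Delta>"
  define h where "h = gbm_mgf_primitive \<tau> \<sigma> \<Delta>"
  define Z where "Z \<omega> = - a * \<Delta> + \<sigma> * X \<omega>" for \<omega>
  have X_meas [measurable]: "X \<in> borel_measurable M"
    using X by (simp add: distributed_def)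
  have Z_meas [measurable]: "Z \<in> borel_measurable M"
    unfolding Z_def[abs_def] by measurable
  have Z_nz: "AE \<omega> in M. Z \<omega> \<noteq> 0"
    using distributed_lborel_AE_neq[OF X, of "a * \<Delta> / \<sigma>"]
    by eventually_elim (use pos in \<open>simp add: Z_def field_simps\<close>)
  have g_int: "has_bochner_integral M (\<lambda>\<omega>. exp (w * Z \<omega>)) (g w)" for w
  proof -
    have "has_bochner_integral M (\<lambda>\<omega>. exp (- a * \<Delta> * w) * exp ((w * \<sigma>) * X \<omega>))
      (exp (- a * \<Delta> * w) * exp ((w * \<sigma>)\<^sup>2 * (sqrt \<Delta>)\<^sup>2 / 2))"
      using pos by (intro has_bochner_integral_mult_right normal_exp_moment[OF X]) simp
    moreover have "exp (- a * \<Delta> * w) * exp ((w * \<sigma>)\<^sup>2 * (sqrt \<Delta>)\<^sup>2 / 2) = g w"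
      unfolding exp_add[symmetric] g_def gbm_mgf_def a_def using pos by (simp add: power_mult_distrib mult_ac)
    moreover have "exp (- a * \<Delta> * w) * exp ((w * \<sigma>) * X \<omega>) = exp (w * Z \<omega>)" for \<omega>
      unfolding exp_add[symmetric] Z_def by (simp add: algebra_simps)
    ultimately show ?thesis by simp
  qed
  have g_meas: "g \<in> borel_measurable borel"
    unfolding g_def gbm_mgf_def[abs_def] by measurable
  have h': "(h has_real_derivative g w) (at w)" for w
    unfolding h_def g_def using pos(2,3) by (rule gbm_mgf_primitive_has_derivative)
  define m where "m w = (g w / \<Delta> + a * h w) / \<sigma>\<^sup>2" for w
  have m': "(m has_real_derivative w * g w) (at w)" for w
    unfolding m_def[abs_def] h_def g_def a_def using pos(2,3) by (rule gbm_mgf_moment_primitive_has_derivative)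
  note rule = expectation_exp_primitive[OF Z_meas _ _ _ g_meas g_int]
  have H0: "AE \<omega> in M. \<forall>w\<in>{p..q}. ((\<lambda>w. exp (w * Z \<omega>) / Z \<omega>) has_real_derivative 1 * exp (w * Z \<omega>)) (at w)" for p q
    using Z_nz by eventually_elim (auto intro!: derivative_eq_intros)
  have L1: "has_bochner_integral M (\<lambda>\<omega>. exp (1 * Z \<omega>) / Z \<omega> - exp (0 * Z \<omega>) / Z \<omega>) (h 1 - h 0)"
    by (rule rule[where H = "\<lambda>z w. exp (w * z) / z" and k = "\<lambda>_. 1"]) (use H0 h' in auto)
  have L2: "has_bochner_integral M (\<lambda>\<omega>. exp (2 * Z \<omega>) / Z \<omega> - exp (1 * Z \<omega>) / Z \<omega>) (h 2 - h 1)"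
    by (rule rule[where H = "\<lambda>z w. exp (w * z) / z" and k = "\<lambda>_. 1"]) (use H0 h' in auto)
  have lin: "lin_factor \<tau> \<sigma> \<Delta> (X \<omega>) = (exp (Z \<omega>) - 1) / Z \<omega>"
    and gbm: "gbm_factor \<tau> \<sigma> \<Delta> (X \<omega>) = exp (Z \<omega>)" for \<omega>
    by (simp_all add: lin_factor_def gbm_factor_def Z_def a_def)
  have exp2: "exp (2 * Z \<omega>) = exp (Z \<omega>) * exp (Z \<omega>)" for \<omega>
    by (simp add: exp_add[symmetric])
  show "has_bochner_integral M (\<lambda>\<omega>. lin_factor \<tau> \<sigma> \<Delta> (X \<omega>)) (L_const \<tau> \<sigma> \<Delta>)"
    using L1 gbm_mgf_primitive_diff_0_1[OF pos(2,3), of \<tau>]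
    by (simp add: lin diff_divide_distrib h_def)
  show "has_bochner_integral M (\<lambda>\<omega>. gbm_factor \<tau> \<sigma> \<Delta> (X \<omega>) * lin_factor \<tau> \<sigma> \<Delta> (X \<omega>))
      (exp (- \<Delta> / \<tau>) * L_tilde \<tau> \<sigma> \<Delta>)"
    using L2 gbm_mgf_primitive_diff_1_2[OF pos]
    by (simp add: lin gbm diff_divide_distrib h_def exp2 right_diff_distrib)
  txt \<open>The square of \<open>\<integral>\<^sub>0\<^sup>1 e\<^sup>w\<^sup>z dw\<close> is \<open>\<integral>\<^sub>0\<^sup>2 min w (2 - w) e\<^sup>w\<^sup>z dw\<close>.\<close>
  have Q1: "has_bochner_integral M
      (\<lambda>\<omega>. (1 / Z \<omega> - 1 / (Z \<omega>)\<^sup>2) * exp (1 * Z \<omega>) - (0 / Z \<omega> - 1 / (Z \<omega>)\<^sup>2) * exp (0 * Z \<omega>)) (m 1 - m 0)"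
  proof (rule rule[where H = "\<lambda>z w. (w / z - 1 / z\<^sup>2) * exp (w * z)" and k = "\<lambda>w. w"])
    show "AE \<omega> in M. \<forall>w\<in>{0..1}. ((\<lambda>w. (w / Z \<omega> - 1 / (Z \<omega>)\<^sup>2) * exp (w * Z \<omega>)) has_real_derivative
        w * exp (w * Z \<omega>)) (at w)"
      using Z_nz by eventually_elim (auto intro!: derivative_eq_intros simp: field_simps power2_eq_square)
  qed (use m' in auto)
  \<comment> \<open>The kernel has a kink at w = 1, so its two linear pieces have separate
    primitives. Terms such as \<open>(2 - 2) / Z \<omega>\<close> stay unevaluated to keep the
    statement a literal instance of \<open>H\<close>.\<close>
  have Q2: "has_bochner_integral M
      (\<lambda>\<omega>. ((2 - 2) / Z \<omega> + 1 / (Z \<omega>)\<^sup>2) * exp (2 * Z \<omega>) - ((2 - 1) / Z \<omega> + 1 / (Z \<omega>)\<^sup>2) * exp (1 * Z \<omega>))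
      ((2 * h 2 - m 2) - (2 * h 1 - m 1))"
  proof (rule rule[where H = "\<lambda>z w. ((2 - w) / z + 1 / z\<^sup>2) * exp (w * z)" and k = "\<lambda>w. 2 - w"])
    show "AE \<omega> in M. \<forall>w\<in>{1..2}. ((\<lambda>w. ((2 - w) / Z \<omega> + 1 / (Z \<omega>)\<^sup>2) * exp (w * Z \<omega>)) has_real_derivative
        (2 - w) * exp (w * Z \<omega>)) (at w)"
      using Z_nz by eventually_elim (auto intro!: derivative_eq_intros simp: field_simps power2_eq_square)
    show "((\<lambda>w. 2 * h w - m w) has_real_derivative (2 - w) * g w) (at w)" for w
      using m'[of w] h'[of w] by (auto intro!: derivative_eq_intros simp: algebra_simps)
  qed auto
  \<comment> \<open>The 1/Z terms of the two pieces cancel at w = 1, leaving (e^(2Z) - 2 e^Z + 1) /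
    Z^2.\<close>
  have "has_bochner_integral M (\<lambda>\<omega>. (lin_factor \<tau> \<sigma> \<Delta> (X \<omega>))\<^sup>2)
      ((m 1 - m 0) + ((2 * h 2 - m 2) - (2 * h 1 - m 1)))"
  proof (subst has_bochner_integral_cong_AE)
    show "AE \<omega> in M. (lin_factor \<tau> \<sigma> \<Delta> (X \<omega>))\<^sup>2 =
      ((1 / Z \<omega> - 1 / (Z \<omega>)\<^sup>2) * exp (1 * Z \<omega>) - (0 / Z \<omega> - 1 / (Z \<omega>)\<^sup>2) * exp (0 * Z \<omega>))
      + (((2 - 2) / Z \<omega> + 1 / (Z \<omega>)\<^sup>2) * exp (2 * Z \<omega>) - ((2 - 1) / Z \<omega> + 1 / (Z \<omega>)\<^sup>2) * exp (1 * Z \<omega>))"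
      using Z_nz by eventually_elim (simp add: lin exp2 exp2[unfolded mult.commute[of 2]] power2_eq_square field_simps)
    show "(\<lambda>\<omega>. (lin_factor \<tau> \<sigma> \<Delta> (X \<omega>))\<^sup>2) \<in> borel_measurable M"
      unfolding lin by measurable
  qed (use has_bochner_integral_add[OF Q1 Q2] in auto)
  moreover have "(m 1 - m 0) + ((2 * h 2 - m 2) - (2 * h 1 - m 1)) = L_bar \<tau> \<sigma> \<Delta>"
    unfolding L_bar_eq[OF pos] m_def a_def[symmetric] g_def[symmetric] h_def[symmetric]
    using pos by (simp add: field_simps)
  ultimately show "has_bochner_integral M (\<lambda>\<omega>. (lin_factor \<tau> \<sigma> \<Delta> (X \<omega>))\<^sup>2) (L_bar \<tau> \<sigma> \<Delta>)"
    by simp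
qed

section \<open>The numerical schemes\<close>

text \<open>The summand \<sigma>^2/2 of \<open>drift_a\<close> compensates the Gaussian half
  variance, so the mean decays at rate 1/\<tau>.\<close>

lemma (in prob_space) gbm_factor_moments:
  assumes X: "distributed M lborel X (normal_density 0 (sqrt \<Delta>))" and "\<Delta> > 0"
  shows "has_bochner_integral M (\<lambda>\<omega>. gbm_factor \<tau> \<sigma> \<Delta> (X \<omega>)) (exp (- \<Delta> / \<tau>))"
    and "has_bochner_integral M (\<lambda>\<omega>. (gbm_factor \<tau> \<sigma> \<Delta> (X \<omega>))\<^sup>2) (exp (\<Delta> * \<sigma>\<^sup>2 - 2 * \<Delta> / \<tau>))"
proof -
  have int: "has_bochner_integral M (\<lambda>\<omega>. exp c * exp (t * X \<omega>)) (exp c * exp (t\<^sup>2 * (sqrt \<Delta>)\<^sup>2 / 2))" for c t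
    using \<open>\<Delta> > 0\<close> by (intro has_bochner_integral_mult_right normal_exp_moment[OF X]) simp
  have "exp (- drift_a \<tau> \<sigma> * \<Delta>) * exp (\<sigma>\<^sup>2 * (sqrt \<Delta>)\<^sup>2 / 2) = exp (- \<Delta> / \<tau>)"
    unfolding exp_add[symmetric] using \<open>\<Delta> > 0\<close> by (simp add: drift_a_def algebra_simps)
  then show "has_bochner_integral M (\<lambda>\<omega>. gbm_factor \<tau> \<sigma> \<Delta> (X \<omega>)) (exp (- \<Delta> / \<tau>))"
    using int[of "- drift_a \<tau> \<sigma> * \<Delta>" \<sigma>] unfolding gbm_factor_def exp_add by simp
  have "exp (2 * (- drift_a \<tau> \<sigma> * \<Delta>)) * exp ((2 * \<sigma>)\<^sup>2 * (sqrt \<Delta>)\<^sup>2 / 2) = exp (\<Delta> * \<sigma>\<^sup>2 - 2 * \<Delta> / \<tau>)"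
    unfolding exp_add[symmetric] using \<open>\<Delta> > 0\<close> by (simp add: drift_a_def power2_eq_square algebra_simps)
  moreover have "(gbm_factor \<tau> \<sigma> \<Delta> x)\<^sup>2 = exp (2 * (- drift_a \<tau> \<sigma> * \<Delta>)) * exp (2 * \<sigma> * x)" for x
    unfolding gbm_factor_def exp_add[symmetric] by (simp add: exp_double[symmetric] algebra_simps)
  ultimately show "has_bochner_integral M (\<lambda>\<omega>. (gbm_factor \<tau> \<sigma> \<Delta> (X \<omega>))\<^sup>2) (exp (\<Delta> * \<sigma>\<^sup>2 - 2 * \<Delta> / \<tau>))"
    using int[of "2 * (- drift_a \<tau> \<sigma> * \<Delta>)" "2 * \<sigma>"] by simp
qed

lemma gbm_factor_measurable [measurable]: "gbm_factor \<tau> \<sigma> \<Delta> \<in> borel_measurable borel"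
  unfolding gbm_factor_def[abs_def] by measurable

lemma lin_factor_measurable [measurable]: "lin_factor \<tau> \<sigma> \<Delta> \<in> borel_measurable borel"
  unfolding lin_factor_def[abs_def] by measurable

text \<open>The exponent of E A^2 is \<Delta> (\<sigma>^2 - 2/\<tau>), so \<sigma>^2 \<tau> < 2 is
  precisely mean-square stability.\<close>

lemma exp_factor_bounds:
  fixes \<tau> \<sigma> \<Delta> :: real
  assumes "\<tau> > 0" "\<Delta> > 0"
  shows "\<bar>exp (- \<Delta> / \<tau>)\<bar> < 1" and "\<sigma>\<^sup>2 * \<tau> < 2 \<Longrightarrow> exp (\<Delta> * \<sigma>\<^sup>2 - 2 * \<Delta> / \<tau>) < 1"
proof -
  show "\<bar>exp (- \<Delta> / \<tau>)\<bar> < 1" using assms by simp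
  assume "\<sigma>\<^sup>2 * \<tau> < 2"
  then have "\<Delta> * (\<sigma>\<^sup>2 * \<tau>) < \<Delta> * 2" using assms by (intro mult_strict_left_mono)
  then have "\<Delta> * \<sigma>\<^sup>2 < 2 * \<Delta> / \<tau>" using assms by (simp add: field_simps)
  then show "exp (\<Delta> * \<sigma>\<^sup>2 - 2 * \<Delta> / \<tau>) < 1" by simp
qed

context independent_noise
begin

text \<open>Independence inside one step: it separates \<phi> from \<psi> in the second Strang
  scheme and alpha from the \<rho>-correction in the log-ODE scheme.\<close>

lemma has_bochner_integral_UV:
  fixes f g :: "real \<Rightarrow> real"
  assumes "f \<in> borel_measurable borel" "g \<in> borel_measurable borel"
    and "has_bochner_integral M (\<lambda>\<omega>. f (U i \<omega>)) x" "has_bochner_integral M (\<lambda>\<omega>. g (V i \<omega>)) y"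
  shows "has_bochner_integral M (\<lambda>\<omega>. f (U i \<omega>) * g (V i \<omega>)) (x * y)"
proof -
  have "indep_var (PiM {Inl i} (\<lambda>_. borel)) (\<lambda>\<omega>. restrict (\<lambda>k. case_sum U V k \<omega>) {Inl i})
      (PiM {Inr i} (\<lambda>_. borel)) (\<lambda>\<omega>. restrict (\<lambda>k. case_sum U V k \<omega>) {Inr i})"
    by (rule indep_var_restrict[OF indep_noise]) auto
  moreover have "(\<lambda>x. f (x (Inl i))) \<in> borel_measurable (PiM {Inl i} (\<lambda>_. borel))"
    "(\<lambda>x. g (x (Inr i))) \<in> borel_measurable (PiM {Inr i} (\<lambda>_. borel))"
    by (intro measurable_compose[OF _ assms(1)] measurable_compose[OF _ assms(2)] measurable_component_singleton; simp)+
  ultimately have "indep_var borel ((\<lambda>x. f (x (Inl i))) \<circ> (\<lambda>\<omega>. restrict (\<lambda>k. case_sum U V k \<omega>) {Inl i}))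
      borel ((\<lambda>x. g (x (Inr i))) \<circ> (\<lambda>\<omega>. restrict (\<lambda>k. case_sum U V k \<omega>) {Inr i}))"
    by (rule indep_var_compose)
  then have "indep_var borel (\<lambda>\<omega>. f (U i \<omega>)) borel (\<lambda>\<omega>. g (V i \<omega>))"
    by (simp add: comp_def)
  from indep_var_integrable[OF this] indep_var_lebesgue_integral[OF this] show ?thesis
    using assms(3,4) by (simp add: has_bochner_integral_iff)
qed

lemma has_bochner_integral_const: "has_bochner_integral M (\<lambda>\<omega>. k) (k :: real)"
  by (simp add: has_bochner_integral_iff prob_space)

section \<open>Euler-Maruyama and Milstein schemes\<close>

lemma euler_maruyama_limits:
  assumes U: "\<And>i. distributed M lborel (U i) (normal_density 0 (sqrt \<Delta>))"
    and pos: "\<tau> > 0" "\<sigma> > 0" "\<Delta> > 0" and small: "\<bar>1 - \<Delta> / \<tau>\<bar> < 1"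
  shows "has_limit_mean M Y0 (euler_maruyama \<tau> \<mu> \<sigma> \<Delta> U Y0) (\<mu> * \<tau>)"
    and "\<Delta> < 2 * \<tau> - \<sigma>\<^sup>2 * \<tau>\<^sup>2 \<Longrightarrow> has_limit_variance M Y0 (euler_maruyama \<tau> \<mu> \<sigma> \<Delta> U Y0)
          ((\<mu> * \<tau>)\<^sup>2 / (2 / (\<sigma>\<^sup>2 * \<tau>) - 1 - \<Delta> / (\<sigma>\<^sup>2 * \<tau>\<^sup>2)))"
proof -
  define a where "a = 1 - \<Delta> / \<tau>"
  define A where "A x = a + \<sigma> * x" for x
  note N = normal_moments[OF U, simplified, OF pos(3)]
  have mean: "has_bochner_integral M (\<lambda>\<omega>. A (U i \<omega>)) a" for i
    unfolding A_def using has_bochner_integral_add[OF has_bochner_integral_const has_bochner_integral_mult_right[OF N(1)], of a \<sigma> i]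
    by simp
  have "has_bochner_integral M (\<lambda>\<omega>. a\<^sup>2 + (2 * a * \<sigma>) * U i \<omega> + \<sigma>\<^sup>2 * (U i \<omega>)\<^sup>2) (a\<^sup>2 + (2 * a * \<sigma>) * 0 + \<sigma>\<^sup>2 * \<Delta>)" for i
    using N pos(3) by (intro has_bochner_integral_add has_bochner_integral_const has_bochner_integral_mult_right) simp_all
  then have square: "has_bochner_integral M (\<lambda>\<omega>. (A (U i \<omega>))\<^sup>2) (a\<^sup>2 + \<sigma>\<^sup>2 * \<Delta>)" for i
    by (simp add: A_def power2_eq_square algebra_simps)
  have A: "A \<in> borel_measurable borel" unfolding A_def[abs_def] by measurable
  note limits = proportional_shift_limits[where Y = "euler_maruyama \<tau> \<mu> \<sigma> \<Delta> U Y0" and ?k1.0 = 0 and ?k2.0 = "\<mu> * \<Delta>", OF A mean square]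
  have rec: "euler_maruyama \<tau> \<mu> \<sigma> \<Delta> U Y0 (Suc i) \<omega> = A (U i \<omega>) * (euler_maruyama \<tau> \<mu> \<sigma> \<Delta> U Y0 i \<omega> + 0) + \<mu> * \<Delta>" for i \<omega>
    by (simp add: A_def a_def Let_def algebra_simps)
  have fixpoint: "\<mu> * \<Delta> / (1 - a) = \<mu> * \<tau>"
    using pos by (simp add: a_def field_simps)
  show "has_limit_mean M Y0 (euler_maruyama \<tau> \<mu> \<sigma> \<Delta> U Y0) (\<mu> * \<tau>)"
    using limits(1)[OF _ rec] small fixpoint by (simp add: a_def)
  assume D: "\<Delta> < 2 * \<tau> - \<sigma>\<^sup>2 * \<tau>\<^sup>2"
  \<comment> \<open>Factored like this, the step size condition is seen to be E A^2 < 1.\<close>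
  have gap: "1 - (a\<^sup>2 + \<sigma>\<^sup>2 * \<Delta>) = \<Delta> / \<tau>\<^sup>2 * (2 * \<tau> - \<sigma>\<^sup>2 * \<tau>\<^sup>2 - \<Delta>)"
    using pos by (simp add: a_def field_simps power2_eq_square)
  have less: "a\<^sup>2 + \<sigma>\<^sup>2 * \<Delta> < 1"
    using gap D pos by (metis diff_gt_0_iff_gt divide_pos_pos mult_pos_pos zero_less_power)
  have den: "2 / (\<sigma>\<^sup>2 * \<tau>) - 1 - \<Delta> / (\<sigma>\<^sup>2 * \<tau>\<^sup>2) = (1 - (a\<^sup>2 + \<sigma>\<^sup>2 * \<Delta>)) / (\<sigma>\<^sup>2 * \<Delta>)"
    unfolding gap using pos by (simp add: field_simps power2_eq_square)
  have "((0 + \<mu> * \<Delta>) / (1 - a))\<^sup>2 * ((a\<^sup>2 + \<sigma>\<^sup>2 * \<Delta> - a\<^sup>2) / (1 - (a\<^sup>2 + \<sigma>\<^sup>2 * \<Delta>)))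
      = (\<mu> * \<tau>)\<^sup>2 / (2 / (\<sigma>\<^sup>2 * \<tau>) - 1 - \<Delta> / (\<sigma>\<^sup>2 * \<tau>\<^sup>2))"
    unfolding den using fixpoint by simp
  then show "has_limit_variance M Y0 (euler_maruyama \<tau> \<mu> \<sigma> \<Delta> U Y0)
          ((\<mu> * \<tau>)\<^sup>2 / (2 / (\<sigma>\<^sup>2 * \<tau>) - 1 - \<Delta> / (\<sigma>\<^sup>2 * \<tau>\<^sup>2)))"
    using limits(2)[OF _ rec _ less] small by (simp add: a_def)
qed

lemma milstein_limits:
  assumes U: "\<And>i. distributed M lborel (U i) (normal_density 0 (sqrt \<Delta>))"
    and pos: "\<tau> > 0" "\<sigma> > 0" "\<Delta> > 0" and small: "\<bar>1 - \<Delta> / \<tau>\<bar> < 1"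
  shows "has_limit_mean M Y0 (milstein \<tau> \<mu> \<sigma> \<Delta> U Y0) (\<mu> * \<tau>)"
    and "\<Delta> < (2 * \<tau> - \<sigma>\<^sup>2 * \<tau>\<^sup>2) / (\<sigma> ^ 4 * \<tau>\<^sup>2 / 2 + 1) \<Longrightarrow>
        has_limit_variance M Y0 (milstein \<tau> \<mu> \<sigma> \<Delta> U Y0)
          ((\<mu> * \<tau>)\<^sup>2 * (1 + \<sigma>\<^sup>2 * \<Delta> / 2)
            / (2 / (\<sigma>\<^sup>2 * \<tau>) - 1 - \<Delta> / (\<sigma>\<^sup>2 * \<tau>\<^sup>2) - \<sigma>\<^sup>2 * \<Delta> / 2))"
proof -
  define a where "a = 1 - \<Delta> / \<tau>"
  define c where "c = \<sigma>\<^sup>2 / 2"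
  define A where "A x = (a - c * \<Delta>) + \<sigma> * x + c * x\<^sup>2" for x
  \<comment> \<open>The variance of \<open>A\<close>: \<sigma>^2 \<Delta> from the linear term and 2
    c^2 \<Delta>^2 = \<sigma>^4 \<Delta>^2 / 2 from the quadratic one; their covariance vanishes
    because odd moments do.\<close>
  define v where "v = \<sigma>\<^sup>2 * \<Delta> * (1 + \<sigma>\<^sup>2 * \<Delta> / 2)"
  note N = normal_moments[OF U, simplified, OF pos(3)]
  have "has_bochner_integral M (\<lambda>\<omega>. A (U i \<omega>)) ((a - c * \<Delta>) + \<sigma> * 0 + c * \<Delta>)" for i
    unfolding A_def using N pos(3)
    by (intro has_bochner_integral_add has_bochner_integral_const has_bochner_integral_mult_right) simp_all
  then have mean: "has_bochner_integral M (\<lambda>\<omega>. A (U i \<omega>)) a" for i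
    by simp
  have sqrt4: "sqrt \<Delta> ^ 4 = \<Delta>\<^sup>2"
    using pos(3) by (simp add: power4_eq_xxxx power2_eq_square)
  have "has_bochner_integral M (\<lambda>\<omega>. (a - c * \<Delta>)\<^sup>2 + (2 * (a - c * \<Delta>) * \<sigma>) * U i \<omega>
        + (\<sigma>\<^sup>2 + 2 * (a - c * \<Delta>) * c) * (U i \<omega>)\<^sup>2 + (2 * \<sigma> * c) * (U i \<omega>) ^ 3 + c\<^sup>2 * (U i \<omega>) ^ 4)
      ((a - c * \<Delta>)\<^sup>2 + (2 * (a - c * \<Delta>) * \<sigma>) * 0 + (\<sigma>\<^sup>2 + 2 * (a - c * \<Delta>) * c) * \<Delta> + (2 * \<sigma> * c) * 0
        + c\<^sup>2 * (3 * \<Delta>\<^sup>2))" for i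
    using N pos(3) sqrt4
    by (intro has_bochner_integral_add has_bochner_integral_const has_bochner_integral_mult_right) simp_all
  moreover have "(a - c * \<Delta>)\<^sup>2 + (2 * (a - c * \<Delta>) * \<sigma>) * 0 + (\<sigma>\<^sup>2 + 2 * (a - c * \<Delta>) * c) * \<Delta> + (2 * \<sigma> * c) * 0
        + c\<^sup>2 * (3 * \<Delta>\<^sup>2) = a\<^sup>2 + v"
    by (simp add: c_def v_def field_simps power2_eq_square)
  moreover have "(a - c * \<Delta>)\<^sup>2 + (2 * (a - c * \<Delta>) * \<sigma>) * x
        + (\<sigma>\<^sup>2 + 2 * (a - c * \<Delta>) * c) * x\<^sup>2 + (2 * \<sigma> * c) * x ^ 3 + c\<^sup>2 * x ^ 4 = (A x)\<^sup>2" for x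
    by (simp add: A_def power2_eq_square power3_eq_cube power4_eq_xxxx algebra_simps)
  ultimately have square: "has_bochner_integral M (\<lambda>\<omega>. (A (U i \<omega>))\<^sup>2) (a\<^sup>2 + v)" for i
    by simp
  have A: "A \<in> borel_measurable borel" unfolding A_def[abs_def] by measurable
  note limits = proportional_shift_limits[where Y = "milstein \<tau> \<mu> \<sigma> \<Delta> U Y0" and ?k1.0 = 0 and ?k2.0 = "\<mu> * \<Delta>", OF A mean square]
  have rec: "milstein \<tau> \<mu> \<sigma> \<Delta> U Y0 (Suc i) \<omega> = A (U i \<omega>) * (milstein \<tau> \<mu> \<sigma> \<Delta> U Y0 i \<omega> + 0) + \<mu> * \<Delta>" for i \<omega>
    by (simp add: A_def a_def c_def Let_def power2_eq_square field_simps)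
  have fixpoint: "\<mu> * \<Delta> / (1 - a) = \<mu> * \<tau>"
    using pos by (simp add: a_def field_simps)
  show "has_limit_mean M Y0 (milstein \<tau> \<mu> \<sigma> \<Delta> U Y0) (\<mu> * \<tau>)"
    using limits(1)[OF _ rec] small fixpoint by (simp add: a_def)
  assume D: "\<Delta> < (2 * \<tau> - \<sigma>\<^sup>2 * \<tau>\<^sup>2) / (\<sigma> ^ 4 * \<tau>\<^sup>2 / 2 + 1)"
  have "\<sigma> ^ 4 * \<tau>\<^sup>2 / 2 + 1 > 0" using pos by (simp add: add_pos_pos)
  then have D': "\<Delta> * (\<sigma> ^ 4 * \<tau>\<^sup>2 / 2 + 1) < 2 * \<tau> - \<sigma>\<^sup>2 * \<tau>\<^sup>2"
    using D by (simp add: pos_less_divide_eq)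
  have gap: "1 - (a\<^sup>2 + v) = \<Delta> / \<tau>\<^sup>2 * (2 * \<tau> - \<sigma>\<^sup>2 * \<tau>\<^sup>2 - \<Delta> * (\<sigma> ^ 4 * \<tau>\<^sup>2 / 2 + 1))"
    using pos by (simp add: a_def v_def field_simps power2_eq_square power4_eq_xxxx)
  have less: "a\<^sup>2 + v < 1"
    using gap D' pos by (metis diff_gt_0_iff_gt divide_pos_pos mult_pos_pos zero_less_power)
  have den: "2 / (\<sigma>\<^sup>2 * \<tau>) - 1 - \<Delta> / (\<sigma>\<^sup>2 * \<tau>\<^sup>2) - \<sigma>\<^sup>2 * \<Delta> / 2 = (1 - (a\<^sup>2 + v)) / (\<sigma>\<^sup>2 * \<Delta>)"
    unfolding gap using pos by (simp add: field_simps power2_eq_square power4_eq_xxxx)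
  have "((0 + \<mu> * \<Delta>) / (1 - a))\<^sup>2 * ((a\<^sup>2 + v - a\<^sup>2) / (1 - (a\<^sup>2 + v)))
      = (\<mu> * \<tau>)\<^sup>2 * (1 + \<sigma>\<^sup>2 * \<Delta> / 2) / (2 / (\<sigma>\<^sup>2 * \<tau>) - 1 - \<Delta> / (\<sigma>\<^sup>2 * \<tau>\<^sup>2) - \<sigma>\<^sup>2 * \<Delta> / 2)"
    unfolding den using fixpoint by (simp add: v_def)
  then show "has_limit_variance M Y0 (milstein \<tau> \<mu> \<sigma> \<Delta> U Y0)
          ((\<mu> * \<tau>)\<^sup>2 * (1 + \<sigma>\<^sup>2 * \<Delta> / 2)
            / (2 / (\<sigma>\<^sup>2 * \<tau>) - 1 - \<Delta> / (\<sigma>\<^sup>2 * \<tau>\<^sup>2) - \<sigma>\<^sup>2 * \<Delta> / 2))"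
    using limits(2)[OF _ rec _ less] small by (simp add: a_def)
qed

section \<open>Splitting schemes\<close>

text \<open>L1, L2 and S1 differ only in how \<mu> \<Delta> is divided between a shift before and
  one after the multiplication. The limit variance depends on the sum alone, which is why the three
  agree; \<open>m\<close> is the limit mean of L1.\<close>

lemma gbm_split_limits:
  fixes m \<mu> :: real
  assumes U: "\<And>i. distributed M lborel (U i) (normal_density 0 (sqrt \<Delta>))"
    and pos: "\<tau> > 0" "\<Delta> > 0"
    and Y: "\<And>\<omega>. Y 0 \<omega> = Y0 \<omega>"
      "\<And>i \<omega>. Y (Suc i) \<omega> = gbm_factor \<tau> \<sigma> \<Delta> (U i \<omega>) * (Y i \<omega> + k1) + k2"
    and k: "k1 + k2 = \<mu> * \<Delta>"
  defines "m \<equiv> \<mu> * \<Delta> / (exp (\<Delta> / \<tau>) - 1)"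
  shows "has_limit_mean M Y0 Y (m + k2)"
    and "\<sigma>\<^sup>2 * \<tau> < 2 \<Longrightarrow> has_limit_variance M Y0 Y
      (m\<^sup>2 * (exp (2 * \<Delta> / \<tau>) * (exp (\<Delta> * \<sigma>\<^sup>2) - 1) / (exp (2 * \<Delta> / \<tau>) - exp (\<Delta> * \<sigma>\<^sup>2))))"
proof -
  define q where "q = exp (\<Delta> / \<tau>)"
  have q: "q > 1" using pos by (simp add: q_def)
  have qq: "exp (- \<Delta> / \<tau>) = 1 / q" "exp (2 * \<Delta> / \<tau>) = q\<^sup>2"
    by (simp_all add: q_def exp_minus field_simps power2_eq_square exp_add[symmetric])
  note limits = proportional_shift_limits[where Y = Y, OF gbm_factor_measurable gbm_factor_moments[OF U pos(2)] Y
      exp_factor_bounds(1)[OF pos]]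
  have "(k1 * (1 / q) + k2) / (1 - 1 / q) = m + k2"
  proof -
    have k1: "k1 = \<mu> * \<Delta> - k2" using k by simp
    show ?thesis unfolding k1 m_def q_def[symmetric] using q by (simp add: field_simps)
  qed
  then show "has_limit_mean M Y0 Y (m + k2)"
    using limits(1) by (simp only: qq)
  assume *: "\<sigma>\<^sup>2 * \<tau> < 2"
  have aa: "exp (\<Delta> * \<sigma>\<^sup>2 - 2 * \<Delta> / \<tau>) = exp (\<Delta> * \<sigma>\<^sup>2) / q\<^sup>2"
    by (simp add: exp_diff qq)
  have "exp (\<Delta> * \<sigma>\<^sup>2) / q\<^sup>2 < 1"
    using exp_factor_bounds(2)[OF pos *] by (simp only: aa)
  then have less: "exp (\<Delta> * \<sigma>\<^sup>2) < q\<^sup>2"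
    using q by simp
  have "(\<mu> * \<Delta> / (1 - 1 / q))\<^sup>2 * ((exp (\<Delta> * \<sigma>\<^sup>2) / q\<^sup>2 - (1 / q)\<^sup>2) / (1 - exp (\<Delta> * \<sigma>\<^sup>2) / q\<^sup>2))
    = m\<^sup>2 * (q\<^sup>2 * (exp (\<Delta> * \<sigma>\<^sup>2) - 1) / (q\<^sup>2 - exp (\<Delta> * \<sigma>\<^sup>2)))"
  proof -
    have "\<mu> * \<Delta> / (1 - 1 / q) = m * q"
      using q by (simp add: m_def q_def[symmetric] field_simps)
    moreover have "(exp (\<Delta> * \<sigma>\<^sup>2) / q\<^sup>2 - (1 / q)\<^sup>2) / (1 - exp (\<Delta> * \<sigma>\<^sup>2) / q\<^sup>2)
        = (exp (\<Delta> * \<sigma>\<^sup>2) - 1) / (q\<^sup>2 - exp (\<Delta> * \<sigma>\<^sup>2))"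
    proof -
      have "exp (\<Delta> * \<sigma>\<^sup>2) / q\<^sup>2 - (1 / q)\<^sup>2 = (exp (\<Delta> * \<sigma>\<^sup>2) - 1) / q\<^sup>2"
        by (simp add: power_divide diff_divide_distrib)
      moreover have "1 - exp (\<Delta> * \<sigma>\<^sup>2) / q\<^sup>2 = (q\<^sup>2 - exp (\<Delta> * \<sigma>\<^sup>2)) / q\<^sup>2"
        using q by (simp add: diff_divide_distrib)
      ultimately show ?thesis using q by simp
    qed
    ultimately show ?thesis by (simp add: power_mult_distrib)
  qed
  then show "has_limit_variance M Y0 Y
      (m\<^sup>2 * (exp (2 * \<Delta> / \<tau>) * (exp (\<Delta> * \<sigma>\<^sup>2) - 1) / (exp (2 * \<Delta> / \<tau>) - exp (\<Delta> * \<sigma>\<^sup>2))))"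
    using limits(2)[OF exp_factor_bounds(2)[OF pos *]] by (simp only: qq aa k)
qed

text \<open>The shift shares only the second Gaussian with the factor, so it is not an affine
  function of the factor and the rule with all five moments is applied.\<close>

lemma strang2_limits:
  fixes m \<mu> :: real
  assumes U: "\<And>i. distributed M lborel (U i) (normal_density 0 (sqrt (\<Delta> / 2)))"
    and V: "\<And>i. distributed M lborel (V i) (normal_density 0 (sqrt (\<Delta> / 2)))"
    and pos: "\<tau> > 0" "\<Delta> > 0"
  defines "m \<equiv> \<mu> * \<Delta> / (exp (\<Delta> / \<tau>) - 1)"
  shows "has_limit_mean M Y0 (strang2 \<tau> \<mu> \<sigma> \<Delta> U V Y0) (m * exp (\<Delta> / (2 * \<tau>)))"
    and "\<sigma>\<^sup>2 * \<tau> < 2 \<Longrightarrow> has_limit_variance M Y0 (strang2 \<tau> \<mu> \<sigma> \<Delta> U V Y0)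
          (m\<^sup>2 * (exp (\<Delta> / \<tau>) * (exp (\<Delta> * \<sigma>\<^sup>2 / 2) - 1) * (exp (2 * \<Delta> / \<tau>) + exp (\<Delta> * \<sigma>\<^sup>2 / 2))
              / (exp (2 * \<Delta> / \<tau>) - exp (\<Delta> * \<sigma>\<^sup>2))))"
proof -
  define A where "A x y = exp (- drift_a \<tau> \<sigma> * \<Delta> + \<sigma> * (x + y))" for x y
  define B where "B x y = \<mu> * \<Delta> * exp (- drift_a \<tau> \<sigma> * \<Delta> / 2 + \<sigma> * y)" for x y :: real
  \<comment> \<open>The shift evolves over half a step, so p is taken as the half-step exponential;
    with r all five moments become rational in p and r.\<close>
  define p where "p = exp (\<Delta> / (2 * \<tau>))"
  define r where "r = exp (\<Delta> * \<sigma>\<^sup>2 / 2)"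
  have p: "p > 1" using pos by (simp add: p_def)
  have pp: "exp (\<Delta> / \<tau>) = p\<^sup>2" "exp (2 * \<Delta> / \<tau>) = p ^ 4" "exp (\<Delta> * \<sigma>\<^sup>2) = r\<^sup>2"
    by (simp_all add: p_def r_def exp_of_nat_mult[symmetric])
  \<comment> \<open>Each variable has variance \<Delta>/2, hence the divisor 4. The pairs (s, t)
    used are (\<sigma>, \<sigma>), (2\<sigma>, 2\<sigma>), (0, \<sigma>), (\<sigma>, 2\<sigma>) and
    (0, 2\<sigma>).\<close>
  have int: "has_bochner_integral M (\<lambda>\<omega>. exp (c + s * U i \<omega> + t * V i \<omega>)) (exp (c + (s\<^sup>2 + t\<^sup>2) * \<Delta> / 4))" for i c s t
  proof -
    have "has_bochner_integral M (\<lambda>\<omega>. exp (s * U i \<omega>) * exp (t * V i \<omega>))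
       (exp (s\<^sup>2 * (sqrt (\<Delta> / 2))\<^sup>2 / 2) * exp (t\<^sup>2 * (sqrt (\<Delta> / 2))\<^sup>2 / 2))"
      using pos normal_exp_moment[OF U] normal_exp_moment[OF V]
      by (intro has_bochner_integral_UV[where f = "\<lambda>x. exp (s * x)" and g = "\<lambda>x. exp (t * x)"]) simp_all
    from has_bochner_integral_mult_right[OF this, of "exp c"]
    have "has_bochner_integral M (\<lambda>\<omega>. exp c * (exp (s * U i \<omega>) * exp (t * V i \<omega>)))
       (exp c * (exp (s\<^sup>2 * (sqrt (\<Delta> / 2))\<^sup>2 / 2) * exp (t\<^sup>2 * (sqrt (\<Delta> / 2))\<^sup>2 / 2)))" .
    then show ?thesis
      using pos by (simp add: exp_add[symmetric] field_simps)
  qed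
  have meas: "case_prod A \<in> borel_measurable (borel \<Otimes>\<^sub>M borel)" "case_prod B \<in> borel_measurable (borel \<Otimes>\<^sub>M borel)"
    unfolding A_def[abs_def] B_def[abs_def] by measurable
  have a: "has_bochner_integral M (\<lambda>\<omega>. A (U i \<omega>) (V i \<omega>)) (1 / p\<^sup>2)" for i
  proof -
    have "exp (- drift_a \<tau> \<sigma> * \<Delta> + (\<sigma>\<^sup>2 + \<sigma>\<^sup>2) * \<Delta> / 4) = exp (- (\<Delta> / \<tau>))"
      using pos by (simp add: drift_a_def field_simps)
    then show ?thesis
      using int[of "- drift_a \<tau> \<sigma> * \<Delta>" \<sigma> i \<sigma>] by (simp add: A_def exp_minus pp field_simps)
  qed
  have aa: "has_bochner_integral M (\<lambda>\<omega>. (A (U i \<omega>) (V i \<omega>))\<^sup>2) (r\<^sup>2 / p ^ 4)" for i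
  proof -
    have "exp (- 2 * drift_a \<tau> \<sigma> * \<Delta> + ((2 * \<sigma>)\<^sup>2 + (2 * \<sigma>)\<^sup>2) * \<Delta> / 4) = exp (\<Delta> * \<sigma>\<^sup>2 - 2 * \<Delta> / \<tau>)"
      using pos by (simp add: drift_a_def field_simps)
    moreover have "(A x y)\<^sup>2 = exp (- 2 * drift_a \<tau> \<sigma> * \<Delta> + (2 * \<sigma>) * x + (2 * \<sigma>) * y)" for x y
      by (simp add: A_def exp_double[symmetric] algebra_simps)
    ultimately show ?thesis
      using int[of "- 2 * drift_a \<tau> \<sigma> * \<Delta>" "2 * \<sigma>" i "2 * \<sigma>"] by (simp add: exp_diff pp)
  qed
  have b: "has_bochner_integral M (\<lambda>\<omega>. B (U i \<omega>) (V i \<omega>)) (\<mu> * \<Delta> * (1 / p))" for i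
  proof -
    have "exp (- drift_a \<tau> \<sigma> * \<Delta> / 2 + (0\<^sup>2 + \<sigma>\<^sup>2) * \<Delta> / 4) = exp (- (\<Delta> / (2 * \<tau>)))"
      using pos by (simp add: drift_a_def field_simps)
    also have "\<dots> = 1 / p"
      by (simp add: exp_minus p_def inverse_eq_divide)
    finally have E: "exp (- drift_a \<tau> \<sigma> * \<Delta> / 2 + (0\<^sup>2 + \<sigma>\<^sup>2) * \<Delta> / 4) = 1 / p" .
    have "B x y = \<mu> * \<Delta> * exp (- drift_a \<tau> \<sigma> * \<Delta> / 2 + 0 * x + \<sigma> * y)" for x y
      by (simp add: B_def)
    then show ?thesis
      using has_bochner_integral_mult_right[OF int[of "- drift_a \<tau> \<sigma> * \<Delta> / 2" 0 i \<sigma>], of "\<mu> * \<Delta>"]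
      by (simp only: E)
  qed
  have ab: "has_bochner_integral M (\<lambda>\<omega>. A (U i \<omega>) (V i \<omega>) * B (U i \<omega>) (V i \<omega>)) (\<mu> * \<Delta> * (r / p ^ 3))" for i
  proof -
    have "exp (- 3 / 2 * drift_a \<tau> \<sigma> * \<Delta> + (\<sigma>\<^sup>2 + (2 * \<sigma>)\<^sup>2) * \<Delta> / 4) = exp (\<Delta> * \<sigma>\<^sup>2 / 2 - 3 * (\<Delta> / (2 * \<tau>)))"
      using pos by (simp add: drift_a_def field_simps)
    also have "\<dots> = r / p ^ 3"
      by (simp add: exp_diff r_def p_def exp_of_nat_mult[symmetric])
    finally have E: "exp (- 3 / 2 * drift_a \<tau> \<sigma> * \<Delta> + (\<sigma>\<^sup>2 + (2 * \<sigma>)\<^sup>2) * \<Delta> / 4) = r / p ^ 3" .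
    have "A x y * B x y = \<mu> * \<Delta> * exp (- 3 / 2 * drift_a \<tau> \<sigma> * \<Delta> + \<sigma> * x + (2 * \<sigma>) * y)" for x y
      by (simp add: A_def B_def exp_add[symmetric] algebra_simps)
    then show ?thesis
      using has_bochner_integral_mult_right[OF int[of "- 3 / 2 * drift_a \<tau> \<sigma> * \<Delta>" \<sigma> i "2 * \<sigma>"], of "\<mu> * \<Delta>"]
      by (simp only: E)
  qed
  have bb: "has_bochner_integral M (\<lambda>\<omega>. (B (U i \<omega>) (V i \<omega>))\<^sup>2) ((\<mu> * \<Delta>)\<^sup>2 * (r / p\<^sup>2))" for i
  proof -
    have "exp (- drift_a \<tau> \<sigma> * \<Delta> + (0\<^sup>2 + (2 * \<sigma>)\<^sup>2) * \<Delta> / 4) = exp (\<Delta> * \<sigma>\<^sup>2 / 2 - \<Delta> / \<tau>)"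
      using pos by (simp add: drift_a_def field_simps)
    also have "\<dots> = r / p\<^sup>2"
      by (simp add: exp_diff r_def pp)
    finally have E: "exp (- drift_a \<tau> \<sigma> * \<Delta> + (0\<^sup>2 + (2 * \<sigma>)\<^sup>2) * \<Delta> / 4) = r / p\<^sup>2" .
    have "(B x y)\<^sup>2 = (\<mu> * \<Delta>)\<^sup>2 * exp (- drift_a \<tau> \<sigma> * \<Delta> + 0 * x + (2 * \<sigma>) * y)" for x y
      by (simp add: B_def power_mult_distrib exp_double[symmetric] algebra_simps)
    then show ?thesis
      using has_bochner_integral_mult_right[OF int[of "- drift_a \<tau> \<sigma> * \<Delta>" 0 i "2 * \<sigma>"], of "(\<mu> * \<Delta>)\<^sup>2"]
      by (simp only: E)
  qed
  have rec: "strang2 \<tau> \<mu> \<sigma> \<Delta> U V Y0 (Suc i) \<omega>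
      = A (U i \<omega>) (V i \<omega>) * strang2 \<tau> \<mu> \<sigma> \<Delta> U V Y0 i \<omega> + B (U i \<omega>) (V i \<omega>)" for i \<omega>
    by (simp add: A_def B_def)
  note limits = affine_recursion_limits[where Y = "strang2 \<tau> \<mu> \<sigma> \<Delta> U V Y0", OF meas a aa b ab bb _ rec]
  have p2: "p\<^sup>2 > 1" using p by (simp add: one_less_power)
  have mc: "\<mu> * \<Delta> = m * (p\<^sup>2 - 1)"
    using p2 by (simp add: m_def pp)
  have lim: "\<mu> * \<Delta> * (1 / p) / (1 - 1 / p\<^sup>2) = m * p"
    unfolding mc using p p2 by (simp add: field_simps power2_eq_square)
  have "\<bar>1 / p\<^sup>2\<bar> < 1" using p2 unfolding abs_less_iff by (simp add: less_divide_eq divide_less_eq)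
  then show "has_limit_mean M Y0 (strang2 \<tau> \<mu> \<sigma> \<Delta> U V Y0) (m * exp (\<Delta> / (2 * \<tau>)))"
    using limits(1) unfolding lim p_def[symmetric] by simp
  assume *: "\<sigma>\<^sup>2 * \<tau> < 2"
  have less: "r\<^sup>2 / p ^ 4 < 1"
    using exp_factor_bounds(2)[OF pos *] by (simp only: exp_diff pp)
  then have less': "r\<^sup>2 < p ^ 4"
    using p by simp
  have "(2 * (\<mu> * \<Delta> * (r / p ^ 3)) * (m * p) + (\<mu> * \<Delta>)\<^sup>2 * (r / p\<^sup>2)) / (1 - r\<^sup>2 / p ^ 4) - (m * p)\<^sup>2
    = m\<^sup>2 * (p\<^sup>2 * (r - 1) * (p ^ 4 + r) / (p ^ 4 - r\<^sup>2))"
  proof -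
    \<comment> \<open>Both terms contain m^2 r (p^2 - 1) / p^2, and the cofactors add up to 2 + (p^2
      - 1) = p^2 + 1.\<close>
    have "2 * (\<mu> * \<Delta> * (r / p ^ 3)) * (m * p) + (\<mu> * \<Delta>)\<^sup>2 * (r / p\<^sup>2) = m\<^sup>2 * r * (p ^ 4 - 1) / p\<^sup>2"
      unfolding mc using p by (simp add: field_simps power2_eq_square power3_eq_cube power4_eq_xxxx)
    moreover have "1 - r\<^sup>2 / p ^ 4 = (p ^ 4 - r\<^sup>2) / p ^ 4"
      using p by (simp add: field_simps)
    moreover have "m\<^sup>2 * r * (p ^ 4 - 1) / p\<^sup>2 / (d / p ^ 4) = m\<^sup>2 * r * (p ^ 4 - 1) * p\<^sup>2 / d" if "d \<noteq> 0" for d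
      using p that by (simp add: field_simps power2_eq_square power4_eq_xxxx)
    \<comment> \<open>The factored form rests on r (p^4 - 1) - (p^4 - r^2) = (r - 1) (p^4 +
      r).\<close>
    moreover have "m\<^sup>2 * r * (p ^ 4 - 1) * p\<^sup>2 / d - (m * p)\<^sup>2 = m\<^sup>2 * (p\<^sup>2 * (r - 1) * (p ^ 4 + r) / d)"
      if "d \<noteq> 0" "d = p ^ 4 - r\<^sup>2" for d
    proof -
      have "m\<^sup>2 * r * (p ^ 4 - 1) * p\<^sup>2 - (m * p)\<^sup>2 * d = m\<^sup>2 * (p\<^sup>2 * (r - 1) * (p ^ 4 + r))"
        by (simp add: that(2) algebra_simps power2_eq_square)
      moreover have "m\<^sup>2 * r * (p ^ 4 - 1) * p\<^sup>2 / d - (m * p)\<^sup>2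
          = (m\<^sup>2 * r * (p ^ 4 - 1) * p\<^sup>2 - (m * p)\<^sup>2 * d) / d"
        using that(1) by (simp add: diff_divide_distrib)
      ultimately show ?thesis by simp
    qed
    ultimately show ?thesis using less' by simp
  qed
  then show "has_limit_variance M Y0 (strang2 \<tau> \<mu> \<sigma> \<Delta> U V Y0)
          (m\<^sup>2 * (exp (\<Delta> / \<tau>) * (exp (\<Delta> * \<sigma>\<^sup>2 / 2) - 1) * (exp (2 * \<Delta> / \<tau>) + exp (\<Delta> * \<sigma>\<^sup>2 / 2))
              / (exp (2 * \<Delta> / \<tau>) - exp (\<Delta> * \<sigma>\<^sup>2))))"
    using limits(2)[OF _ less] unfolding lim pp r_def[symmetric] by simp
qed

section \<open>ODE schemes\<close>

text \<open>Both ODE schemes have the shift \<mu> \<Delta> alpha R with R independent of alpha: R =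
  1 for Lin, a quadratic in \<rho> for Log. Terms linear in the shift pick up E R and the square
  picks up E R^2, which explains the common factor of \<open>K_const\<close> and
  \<open>K_tilde\<close> and the different one of \<open>K_bar\<close>.\<close>

lemma gbm_ode_limits:
  fixes R :: "real \<Rightarrow> real" and m \<mu> L Lt Lb :: real
  assumes U: "\<And>i. distributed M lborel (U i) (normal_density 0 (sqrt \<Delta>))"
    and pos: "\<tau> > 0" "\<sigma> > 0" "\<Delta> > 0"
    and R: "R \<in> borel_measurable borel" "\<And>i. has_bochner_integral M (\<lambda>\<omega>. R (V i \<omega>)) r1"
      "\<And>i. has_bochner_integral M (\<lambda>\<omega>. (R (V i \<omega>))\<^sup>2) r2"
    and Y: "\<And>\<omega>. Y 0 \<omega> = Y0 \<omega>"
      "\<And>i \<omega>. Y (Suc i) \<omega> = Y i \<omega> * gbm_factor \<tau> \<sigma> \<Delta> (U i \<omega>) + \<mu> * \<Delta> * lin_factor \<tau> \<sigma> \<Delta> (U i \<omega>) * R (V i \<omega>)"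
  defines "m \<equiv> \<mu> * \<Delta> / (exp (\<Delta> / \<tau>) - 1)"
    and "L \<equiv> L_const \<tau> \<sigma> \<Delta> * r1" and "Lt \<equiv> L_tilde \<tau> \<sigma> \<Delta> * r1" and "Lb \<equiv> L_bar \<tau> \<sigma> \<Delta> * r2"
  shows "has_limit_mean M Y0 Y (m * exp (\<Delta> / \<tau>) * L)"
    and "\<sigma>\<^sup>2 * \<tau> < 2 \<Longrightarrow> has_limit_variance M Y0 Y
          (m\<^sup>2 * (exp (2 * \<Delta> / \<tau>)
                * (2 * L * Lt * (exp (\<Delta> / \<tau>) - 1) + Lb * (exp (\<Delta> / \<tau>) - 1)\<^sup>2
                   + L\<^sup>2 * (exp (\<Delta> * \<sigma>\<^sup>2) - exp (2 * \<Delta> / \<tau>)))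
              / (exp (2 * \<Delta> / \<tau>) - exp (\<Delta> * \<sigma>\<^sup>2))))"
proof -
  define q where "q = exp (\<Delta> / \<tau>)"
  define s where "s = exp (\<Delta> * \<sigma>\<^sup>2)"
  define c where "c = \<mu> * \<Delta>"
  define A where "A x y = gbm_factor \<tau> \<sigma> \<Delta> x" for x y :: real
  define B where "B x y = c * (lin_factor \<tau> \<sigma> \<Delta> x * R y)" for x y
  have q: "q > 1" using pos by (simp add: q_def)
  have qq: "exp (- \<Delta> / \<tau>) = 1 / q" "exp (2 * \<Delta> / \<tau>) = q\<^sup>2" "exp (\<Delta> * \<sigma>\<^sup>2 - 2 * \<Delta> / \<tau>) = s / q\<^sup>2"
    by (simp_all add: q_def s_def exp_minus exp_diff field_simps power2_eq_square exp_add[symmetric])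
  note gbm = gbm_factor_moments[where \<tau> = \<tau> and \<sigma> = \<sigma>, OF U pos(3), unfolded qq]
  note lin = lin_factor_moments[OF U pos, unfolded qq]
  note [measurable] = R(1)
  have meas: "case_prod A \<in> borel_measurable (borel \<Otimes>\<^sub>M borel)" "case_prod B \<in> borel_measurable (borel \<Otimes>\<^sub>M borel)"
    unfolding A_def[abs_def] B_def[abs_def] by measurable
  have a: "has_bochner_integral M (\<lambda>\<omega>. A (U i \<omega>) (V i \<omega>)) (1 / q)" for i
    using gbm(1) by (simp add: A_def)
  have aa: "has_bochner_integral M (\<lambda>\<omega>. (A (U i \<omega>) (V i \<omega>))\<^sup>2) (s / q\<^sup>2)" for i
    using gbm(2) by (simp add: A_def)
  have b: "has_bochner_integral M (\<lambda>\<omega>. B (U i \<omega>) (V i \<omega>)) (c * L)" for i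
    unfolding B_def L_def by (intro has_bochner_integral_mult_right has_bochner_integral_UV R lin) measurable
  have ab: "has_bochner_integral M (\<lambda>\<omega>. A (U i \<omega>) (V i \<omega>) * B (U i \<omega>) (V i \<omega>)) (c * (1 / q * Lt))" for i
  proof -
    have "has_bochner_integral M (\<lambda>\<omega>. c * ((gbm_factor \<tau> \<sigma> \<Delta> (U i \<omega>) * lin_factor \<tau> \<sigma> \<Delta> (U i \<omega>)) * R (V i \<omega>)))
        (c * ((1 / q * L_tilde \<tau> \<sigma> \<Delta>) * r1))"
      by (intro has_bochner_integral_mult_right
          has_bochner_integral_UV[where f = "\<lambda>x. gbm_factor \<tau> \<sigma> \<Delta> x * lin_factor \<tau> \<sigma> \<Delta> x"] R lin) measurable
    then show ?thesis by (simp add: A_def B_def Lt_def mult_ac)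
  qed
  have bb: "has_bochner_integral M (\<lambda>\<omega>. (B (U i \<omega>) (V i \<omega>))\<^sup>2) (c\<^sup>2 * Lb)" for i
  proof -
    have "has_bochner_integral M (\<lambda>\<omega>. c\<^sup>2 * ((lin_factor \<tau> \<sigma> \<Delta> (U i \<omega>))\<^sup>2 * (R (V i \<omega>))\<^sup>2)) (c\<^sup>2 * (L_bar \<tau> \<sigma> \<Delta> * r2))"
      by (intro has_bochner_integral_mult_right
          has_bochner_integral_UV[where f = "\<lambda>x. (lin_factor \<tau> \<sigma> \<Delta> x)\<^sup>2" and g = "\<lambda>x. (R x)\<^sup>2"] R lin) measurable
    then show ?thesis by (simp add: B_def Lb_def power_mult_distrib)
  qed
  have rec: "Y (Suc i) \<omega> = A (U i \<omega>) (V i \<omega>) * Y i \<omega> + B (U i \<omega>) (V i \<omega>)" for i \<omega>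
    by (simp add: Y A_def B_def c_def mult_ac)
  note limits = affine_recursion_limits[where Y = Y, OF meas a aa b ab bb Y(1) rec]
  have c: "c = m * (q - 1)" unfolding m_def c_def q_def[symmetric] using q by simp
  have lim: "c * L / (1 - 1 / q) = m * q * L"
    unfolding c using q by (simp add: field_simps)
  have "\<bar>1 / q\<bar> < 1" using q by simp
  from limits(1)[OF this] show "has_limit_mean M Y0 Y (m * exp (\<Delta> / \<tau>) * L)"
    unfolding lim by (simp only: q_def)
  assume *: "\<sigma>\<^sup>2 * \<tau> < 2"
  have less: "s / q\<^sup>2 < 1"
    using exp_factor_bounds(2)[OF pos(1,3) *] by (simp only: qq)
  then have less': "s < q\<^sup>2"
    using q by simp
  have "(2 * (c * (1 / q * Lt)) * (m * q * L) + c\<^sup>2 * Lb) / (1 - s / q\<^sup>2) - (m * q * L)\<^sup>2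
    = m\<^sup>2 * (q\<^sup>2 * (2 * L * Lt * (q - 1) + Lb * (q - 1)\<^sup>2 + L\<^sup>2 * (s - q\<^sup>2)) / (q\<^sup>2 - s))"
  proof -
    define N where "N = 2 * L * Lt * (q - 1) + Lb * (q - 1)\<^sup>2"
    define d where "d = q\<^sup>2 - s"
    have d: "d \<noteq> 0" "s - q\<^sup>2 = - d" "1 - s / q\<^sup>2 = d / q\<^sup>2"
      using less' q by (simp_all add: d_def diff_divide_distrib)
    \<comment> \<open>With \<open>c = m * (q - 1)\<close>, the 1/q in E AB cancels the q in the
      limit mean.\<close>
    have "2 * (c * (1 / q * Lt)) * (m * q * L) + c\<^sup>2 * Lb = m\<^sup>2 * N"
      unfolding c N_def using q by (simp add: field_simps power2_eq_square)
    then have "(2 * (c * (1 / q * Lt)) * (m * q * L) + c\<^sup>2 * Lb) / (1 - s / q\<^sup>2) - (m * q * L)\<^sup>2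
        = m\<^sup>2 * N / (d / q\<^sup>2) - (m * q * L)\<^sup>2"
      unfolding d(3) by simp
    also have "\<dots> = m\<^sup>2 * (q\<^sup>2 * (N + L\<^sup>2 * (- d)) / d)"
      using d(1) by (simp add: field_simps)
    finally show ?thesis
      unfolding d(2) N_def d_def .
  qed
  then show "has_limit_variance M Y0 Y
          (m\<^sup>2 * (exp (2 * \<Delta> / \<tau>)
                * (2 * L * Lt * (exp (\<Delta> / \<tau>) - 1) + Lb * (exp (\<Delta> / \<tau>) - 1)\<^sup>2
                   + L\<^sup>2 * (exp (\<Delta> * \<sigma>\<^sup>2) - exp (2 * \<Delta> / \<tau>)))
              / (exp (2 * \<Delta> / \<tau>) - exp (\<Delta> * \<sigma>\<^sup>2))))"
    using limits(2)[OF less] unfolding lim qq q_def[symmetric] s_def[symmetric] by simp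
qed

lemma log_ode_correction_moments:
  fixes \<sigma> \<Delta> :: real
  assumes V: "\<And>i. distributed M lborel (V i) (normal_density 0 (sqrt (\<Delta> / 12)))" and "\<Delta> > 0"
  defines "R \<equiv> \<lambda>x. 1 - \<sigma> * x + \<sigma>\<^sup>2 * (3 / 5 * x\<^sup>2 + \<Delta> / 30)"
  shows "has_bochner_integral M (\<lambda>\<omega>. R (V i \<omega>)) (1 + \<sigma>\<^sup>2 * \<Delta> / 12)"
    and "has_bochner_integral M (\<lambda>\<omega>. (R (V i \<omega>))\<^sup>2) (1 + \<sigma>\<^sup>2 * \<Delta> / 4 + 43 / 3600 * \<sigma> ^ 4 * \<Delta>\<^sup>2)"
proof -
  define k where "k = 1 + \<sigma>\<^sup>2 * \<Delta> / 30"
  define l where "l = 3 / 5 * \<sigma>\<^sup>2"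
  have R: "R x = k + - \<sigma> * x + l * x\<^sup>2" for x
    by (simp add: R_def k_def l_def algebra_simps)
  have N: "has_bochner_integral M (V i) 0" "has_bochner_integral M (\<lambda>\<omega>. (V i \<omega>)\<^sup>2) (\<Delta> / 12)"
    "has_bochner_integral M (\<lambda>\<omega>. (V i \<omega>) ^ 3) 0" "has_bochner_integral M (\<lambda>\<omega>. (V i \<omega>) ^ 4) (\<Delta>\<^sup>2 / 48)"
  proof -
    have "sqrt (\<Delta> / 12) ^ 4 = (\<Delta> / 12)\<^sup>2"
      using \<open>\<Delta> > 0\<close> power_mult[of "sqrt (\<Delta> / 12)" 2 2] by simp
    then have s4: "3 * sqrt (\<Delta> / 12) ^ 4 = \<Delta>\<^sup>2 / 48"
      by (simp add: power2_eq_square)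
    have s: "sqrt (\<Delta> / 12) > 0" "(sqrt (\<Delta> / 12))\<^sup>2 = \<Delta> / 12"
      using \<open>\<Delta> > 0\<close> by simp_all
    show "has_bochner_integral M (V i) 0" "has_bochner_integral M (\<lambda>\<omega>. (V i \<omega>)\<^sup>2) (\<Delta> / 12)"
      "has_bochner_integral M (\<lambda>\<omega>. (V i \<omega>) ^ 3) 0" "has_bochner_integral M (\<lambda>\<omega>. (V i \<omega>) ^ 4) (\<Delta>\<^sup>2 / 48)"
      using normal_moments[OF V s(1), of i] unfolding s(2) s4 by - assumption+
  qed
  have "has_bochner_integral M (\<lambda>\<omega>. k + - \<sigma> * V i \<omega> + l * (V i \<omega>)\<^sup>2) (k + - \<sigma> * 0 + l * (\<Delta> / 12))"
    by (intro has_bochner_integral_add has_bochner_integral_const has_bochner_integral_mult_right N)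
  \<comment> \<open>3/5 * 1/12 + 1/30 = 1/12.\<close>
  moreover have "k + - \<sigma> * 0 + l * (\<Delta> / 12) = 1 + \<sigma>\<^sup>2 * \<Delta> / 12"
    by (simp add: k_def l_def field_simps)
  ultimately show "has_bochner_integral M (\<lambda>\<omega>. R (V i \<omega>)) (1 + \<sigma>\<^sup>2 * \<Delta> / 12)"
    by (simp add: R)
  have "has_bochner_integral M (\<lambda>\<omega>. k\<^sup>2 + (- 2 * k * \<sigma>) * V i \<omega> + (\<sigma>\<^sup>2 + 2 * k * l) * (V i \<omega>)\<^sup>2
        + (- 2 * \<sigma> * l) * (V i \<omega>) ^ 3 + l\<^sup>2 * (V i \<omega>) ^ 4)
      (k\<^sup>2 + (- 2 * k * \<sigma>) * 0 + (\<sigma>\<^sup>2 + 2 * k * l) * (\<Delta> / 12) + (- 2 * \<sigma> * l) * 0 + l\<^sup>2 * (\<Delta>\<^sup>2 / 48))"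
    by (intro has_bochner_integral_add has_bochner_integral_const has_bochner_integral_mult_right N)
  \<comment> \<open>At order \<sigma>^2 \<Delta>: 1/15 + 1/12 + 1/10 = 1/4. At order \<sigma>^4
    \<Delta>^2: 1/900 + 1/300 + 3/400 = 43/3600, from k^2, from the product of k and l, and from the
    fourth moment.\<close>
  moreover have "k\<^sup>2 + (- 2 * k * \<sigma>) * 0 + (\<sigma>\<^sup>2 + 2 * k * l) * (\<Delta> / 12) + (- 2 * \<sigma> * l) * 0 + l\<^sup>2 * (\<Delta>\<^sup>2 / 48)
      = 1 + \<sigma>\<^sup>2 * \<Delta> / 4 + 43 / 3600 * \<sigma> ^ 4 * \<Delta>\<^sup>2"
    by (simp add: k_def l_def power2_eq_square power4_eq_xxxx field_simps)
  moreover have "k\<^sup>2 + (- 2 * k * \<sigma>) * x + (\<sigma>\<^sup>2 + 2 * k * l) * x\<^sup>2 + (- 2 * \<sigma> * l) * x ^ 3 + l\<^sup>2 * x ^ 4 = (R x)\<^sup>2" for x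
    unfolding R by (simp add: power2_eq_square power3_eq_cube power4_eq_xxxx algebra_simps)
  ultimately show "has_bochner_integral M (\<lambda>\<omega>. (R (V i \<omega>))\<^sup>2) (1 + \<sigma>\<^sup>2 * \<Delta> / 4 + 43 / 3600 * \<sigma> ^ 4 * \<Delta>\<^sup>2)"
    by simp
qed

end

theorem corollary2:
  fixes M :: "'a measure"
    and \<tau> \<sigma> \<mu> \<Delta> :: real
    and Y0 :: "'a \<Rightarrow> real"
    and \<xi> \<rho> \<phi> \<psi> :: "nat \<Rightarrow> 'a \<Rightarrow> real"
    and eL1 L Lt Lb K Kt Kb :: real
  assumes "prob_space M"
    and "\<tau> > 0" and "\<sigma> > 0" and "\<Delta> > 0"
    and "Y0 \<in> borel_measurable M"
    and "AE \<omega> in M. Y0 \<omega> \<ge> 0"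
    and "integrable M (\<lambda>\<omega>. (Y0 \<omega>)\<^sup>2)"
    and "\<And>i. distributed M lborel (\<xi> i) (normal_density 0 (sqrt \<Delta>))"
    and "\<And>i. distributed M lborel (\<rho> i) (normal_density 0 (sqrt (\<Delta> / 12)))"
    and "\<And>i. distributed M lborel (\<phi> i) (normal_density 0 (sqrt (\<Delta> / 2)))"
    and "\<And>i. distributed M lborel (\<psi> i) (normal_density 0 (sqrt (\<Delta> / 2)))"
    and "prob_space.indep_vars M (\<lambda>_. borel) (case_sum \<xi> \<rho>) UNIV"
    and "prob_space.indep_vars M (\<lambda>_. borel) (case_sum \<phi> \<psi>) UNIV"
    and "prob_space.indep_set M (sets (sigma_of M Y0))
           (sets (vimage_algebra (space M)
              (\<lambda>\<omega> k. case_sum (case_sum \<xi> \<rho>) (case_sum \<phi> \<psi>) k \<omega>) (\<Pi>\<^sub>M k\<in>UNIV. borel)))"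
  defines "eL1 \<equiv> \<mu> * \<tau> * ((\<Delta> / \<tau>) / (exp (\<Delta> / \<tau>) - 1))"
    and "L \<equiv> L_const \<tau> \<sigma> \<Delta>" and "Lt \<equiv> L_tilde \<tau> \<sigma> \<Delta>" and "Lb \<equiv> L_bar \<tau> \<sigma> \<Delta>"
    and "K \<equiv> K_const \<tau> \<sigma> \<Delta>" and "Kt \<equiv> K_tilde \<tau> \<sigma> \<Delta>" and "Kb \<equiv> K_bar \<tau> \<sigma> \<Delta>"
  shows
    "(\<bar>1 - \<Delta> / \<tau>\<bar> < 1 \<longrightarrow>
        has_limit_mean M Y0 (euler_maruyama \<tau> \<mu> \<sigma> \<Delta> \<xi> Y0) (\<mu> * \<tau>) \<and>
        has_limit_mean M Y0 (milstein \<tau> \<mu> \<sigma> \<Delta> \<xi> Y0) (\<mu> * \<tau>))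
   \<and> (\<bar>1 - \<Delta> / \<tau>\<bar> < 1 \<and> \<Delta> < 2 * \<tau> - \<sigma>\<^sup>2 * \<tau>\<^sup>2 \<longrightarrow>
        has_limit_variance M Y0 (euler_maruyama \<tau> \<mu> \<sigma> \<Delta> \<xi> Y0)
          ((\<mu> * \<tau>)\<^sup>2 / (2 / (\<sigma>\<^sup>2 * \<tau>) - 1 - \<Delta> / (\<sigma>\<^sup>2 * \<tau>\<^sup>2))))
   \<and> (\<bar>1 - \<Delta> / \<tau>\<bar> < 1 \<and> \<Delta> < (2 * \<tau> - \<sigma>\<^sup>2 * \<tau>\<^sup>2) / (\<sigma> ^ 4 * \<tau>\<^sup>2 / 2 + 1) \<longrightarrow>
        has_limit_variance M Y0 (milstein \<tau> \<mu> \<sigma> \<Delta> \<xi> Y0)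
          ((\<mu> * \<tau>)\<^sup>2 * (1 + \<sigma>\<^sup>2 * \<Delta> / 2)
            / (2 / (\<sigma>\<^sup>2 * \<tau>) - 1 - \<Delta> / (\<sigma>\<^sup>2 * \<tau>\<^sup>2) - \<sigma>\<^sup>2 * \<Delta> / 2)))
   \<and> has_limit_mean M Y0 (lie_trotter1 \<tau> \<mu> \<sigma> \<Delta> \<xi> Y0) eL1
   \<and> (has_limit_mean M Y0 (lie_trotter2 \<tau> \<mu> \<sigma> \<Delta> \<xi> Y0) (eL1 + \<mu> * \<Delta>) \<and>
        eL1 + \<mu> * \<Delta> = eL1 * exp (\<Delta> / \<tau>))
   \<and> (has_limit_mean M Y0 (strang1 \<tau> \<mu> \<sigma> \<Delta> \<xi> Y0) (eL1 + \<mu> * \<Delta> / 2) \<and>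
        eL1 + \<mu> * \<Delta> / 2 = 1 / 2 * eL1 * (1 + exp (\<Delta> / \<tau>)))
   \<and> has_limit_mean M Y0 (strang2 \<tau> \<mu> \<sigma> \<Delta> \<phi> \<psi> Y0) (eL1 * exp (\<Delta> / (2 * \<tau>)))
   \<and> (\<sigma>\<^sup>2 * \<tau> < 2 \<longrightarrow>
        (\<forall>Y \<in> {lie_trotter1 \<tau> \<mu> \<sigma> \<Delta> \<xi> Y0, lie_trotter2 \<tau> \<mu> \<sigma> \<Delta> \<xi> Y0, strang1 \<tau> \<mu> \<sigma> \<Delta> \<xi> Y0}.
           has_limit_variance M Y0 Y
             (eL1\<^sup>2 * (exp (2 * \<Delta> / \<tau>) * (exp (\<Delta> * \<sigma>\<^sup>2) - 1)
                / (exp (2 * \<Delta> / \<tau>) - exp (\<Delta> * \<sigma>\<^sup>2))))))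
   \<and> (\<sigma>\<^sup>2 * \<tau> < 2 \<longrightarrow>
        has_limit_variance M Y0 (strang2 \<tau> \<mu> \<sigma> \<Delta> \<phi> \<psi> Y0)
          (eL1\<^sup>2 * (exp (\<Delta> / \<tau>) * (exp (\<Delta> * \<sigma>\<^sup>2 / 2) - 1)
                * (exp (2 * \<Delta> / \<tau>) + exp (\<Delta> * \<sigma>\<^sup>2 / 2))
              / (exp (2 * \<Delta> / \<tau>) - exp (\<Delta> * \<sigma>\<^sup>2)))))
   \<and> has_limit_mean M Y0 (piecewise_linear \<tau> \<mu> \<sigma> \<Delta> \<xi> Y0) (eL1 * exp (\<Delta> / \<tau>) * L)
   \<and> has_limit_mean M Y0 (log_ode \<tau> \<mu> \<sigma> \<Delta> \<xi> \<rho> Y0)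
        (eL1 * exp (\<Delta> / \<tau>) * L * (1 + \<sigma>\<^sup>2 * (\<Delta> / 12)))
   \<and> (\<sigma>\<^sup>2 * \<tau> < 2 \<longrightarrow>
        has_limit_variance M Y0 (piecewise_linear \<tau> \<mu> \<sigma> \<Delta> \<xi> Y0)
          (eL1\<^sup>2 * (exp (2 * \<Delta> / \<tau>)
                * (2 * L * Lt * (exp (\<Delta> / \<tau>) - 1) + Lb * (exp (\<Delta> / \<tau>) - 1)\<^sup>2
                   + L\<^sup>2 * (exp (\<Delta> * \<sigma>\<^sup>2) - exp (2 * \<Delta> / \<tau>)))
              / (exp (2 * \<Delta> / \<tau>) - exp (\<Delta> * \<sigma>\<^sup>2)))))
   \<and> (\<sigma>\<^sup>2 * \<tau> < 2 \<longrightarrow>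
        has_limit_variance M Y0 (log_ode \<tau> \<mu> \<sigma> \<Delta> \<xi> \<rho> Y0)
          (eL1\<^sup>2 * (exp (2 * \<Delta> / \<tau>)
                * (2 * K * Kt * (exp (\<Delta> / \<tau>) - 1) + Kb * (exp (\<Delta> / \<tau>) - 1)\<^sup>2
                   + K\<^sup>2 * (exp (\<Delta> * \<sigma>\<^sup>2) - exp (2 * \<Delta> / \<tau>)))
              / (exp (2 * \<Delta> / \<tau>) - exp (\<Delta> * \<sigma>\<^sup>2)))))"
proof -
  interpret prob_space M by fact
  note pos = \<open>\<tau> > 0\<close> \<open>\<sigma> > 0\<close> \<open>\<Delta> > 0\<close>
  note \<xi> = assms(8) and \<rho> = assms(9) and \<phi> = assms(10) and \<psi> = assms(11)
  let ?noise = "case_sum (case_sum \<xi> \<rho>) (case_sum \<phi> \<psi>)"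
  \<comment> \<open>The joint sigma-algebra of all four families; every single variable is a
    coordinate of the generating map, so this \<open>G\<close> serves both interpretations
    below.\<close>
  define G where "G = vimage_algebra (space M) (\<lambda>\<omega> k. ?noise k \<omega>) (\<Pi>\<^sub>M k\<in>UNIV. borel)"
  have space_G: "space G = space M" by (simp add: G_def)
  have noise: "?noise k \<in> borel_measurable G" for k
  proof -
    have "(\<lambda>\<omega> k. ?noise k \<omega>) \<in> G \<rightarrow>\<^sub>M (\<Pi>\<^sub>M k\<in>UNIV. borel)"
      unfolding G_def by (rule measurable_vimage_algebra1) (simp add: space_PiM)
    from measurable_compose[OF this measurable_component_singleton[of k]] show ?thesis by simp
  qed
  note start = assms(14)[folded G_def]
  interpret \<xi>\<rho>: independent_noise M G Y0 \<xi> \<rho>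
  proof unfold_locales
    show "\<xi> i \<in> borel_measurable G" "\<rho> i \<in> borel_measurable G" for i
      using noise[of "Inl (Inl i)"] noise[of "Inl (Inr i)"] by simp_all
  qed (fact assms start space_G)+
  interpret \<phi>\<psi>: independent_noise M G Y0 \<phi> \<psi>
  proof unfold_locales
    show "\<phi> i \<in> borel_measurable G" "\<psi> i \<in> borel_measurable G" for i
      using noise[of "Inr (Inl i)"] noise[of "Inr (Inr i)"] by simp_all
  qed (fact assms start space_G)+
  have exp_gt: "exp (\<Delta> / \<tau>) > 1" using pos by simp
  have eL1: "eL1 = \<mu> * \<Delta> / (exp (\<Delta> / \<tau>) - 1)"
    using pos by (simp add: eL1_def)
  have shift: "\<mu> * \<Delta> = eL1 * (exp (\<Delta> / \<tau>) - 1)"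
    unfolding eL1 using exp_gt by (metis diff_gt_0_iff_gt less_irrefl nonzero_eq_divide_eq)
  have shifted: "eL1 + \<mu> * \<Delta> = eL1 * exp (\<Delta> / \<tau>)"
    "eL1 + \<mu> * \<Delta> / 2 = 1 / 2 * eL1 * (1 + exp (\<Delta> / \<tau>))"
    unfolding shift by (simp_all add: field_simps)
  note split = \<xi>\<rho>.gbm_split_limits[OF \<xi> pos(1,3), where \<sigma> = \<sigma> and \<mu> = \<mu>, folded eL1]
  have "has_limit_mean M Y0 (lie_trotter1 \<tau> \<mu> \<sigma> \<Delta> \<xi> Y0) (eL1 + 0)"
    and L1: "\<sigma>\<^sup>2 * \<tau> < 2 \<Longrightarrow> has_limit_variance M Y0 (lie_trotter1 \<tau> \<mu> \<sigma> \<Delta> \<xi> Y0)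
      (eL1\<^sup>2 * (exp (2 * \<Delta> / \<tau>) * (exp (\<Delta> * \<sigma>\<^sup>2) - 1) / (exp (2 * \<Delta> / \<tau>) - exp (\<Delta> * \<sigma>\<^sup>2))))"
    by (rule split[where ?k1.0 = "\<mu> * \<Delta>" and ?k2.0 = 0]; simp)+
  then have L1_mean: "has_limit_mean M Y0 (lie_trotter1 \<tau> \<mu> \<sigma> \<Delta> \<xi> Y0) eL1" by simp
  have L2: "has_limit_mean M Y0 (lie_trotter2 \<tau> \<mu> \<sigma> \<Delta> \<xi> Y0) (eL1 + \<mu> * \<Delta>)"
    "\<sigma>\<^sup>2 * \<tau> < 2 \<Longrightarrow> has_limit_variance M Y0 (lie_trotter2 \<tau> \<mu> \<sigma> \<Delta> \<xi> Y0)
      (eL1\<^sup>2 * (exp (2 * \<Delta> / \<tau>) * (exp (\<Delta> * \<sigma>\<^sup>2) - 1) / (exp (2 * \<Delta> / \<tau>) - exp (\<Delta> * \<sigma>\<^sup>2))))"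
    by (rule split[where ?k1.0 = 0 and ?k2.0 = "\<mu> * \<Delta>"]; simp add: mult.commute)+
  have S1: "has_limit_mean M Y0 (strang1 \<tau> \<mu> \<sigma> \<Delta> \<xi> Y0) (eL1 + \<mu> * \<Delta> / 2)"
    "\<sigma>\<^sup>2 * \<tau> < 2 \<Longrightarrow> has_limit_variance M Y0 (strang1 \<tau> \<mu> \<sigma> \<Delta> \<xi> Y0)
      (eL1\<^sup>2 * (exp (2 * \<Delta> / \<tau>) * (exp (\<Delta> * \<sigma>\<^sup>2) - 1) / (exp (2 * \<Delta> / \<tau>) - exp (\<Delta> * \<sigma>\<^sup>2))))"
    by (rule split[where ?k1.0 = "\<mu> * \<Delta> / 2" and ?k2.0 = "\<mu> * \<Delta> / 2"]; simp)+
  have S2: "has_limit_mean M Y0 (strang2 \<tau> \<mu> \<sigma> \<Delta> \<phi> \<psi> Y0) (eL1 * exp (\<Delta> / (2 * \<tau>)))"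
    "\<sigma>\<^sup>2 * \<tau> < 2 \<Longrightarrow> has_limit_variance M Y0 (strang2 \<tau> \<mu> \<sigma> \<Delta> \<phi> \<psi> Y0)
          (eL1\<^sup>2 * (exp (\<Delta> / \<tau>) * (exp (\<Delta> * \<sigma>\<^sup>2 / 2) - 1) * (exp (2 * \<Delta> / \<tau>) + exp (\<Delta> * \<sigma>\<^sup>2 / 2))
              / (exp (2 * \<Delta> / \<tau>) - exp (\<Delta> * \<sigma>\<^sup>2))))"
    unfolding eL1 by (rule \<phi>\<psi>.strang2_limits(1)[OF \<phi> \<psi> pos(1,3)], rule \<phi>\<psi>.strang2_limits(2)[OF \<phi> \<psi> pos(1,3)])
  have Lin: "has_limit_mean M Y0 (piecewise_linear \<tau> \<mu> \<sigma> \<Delta> \<xi> Y0) (eL1 * exp (\<Delta> / \<tau>) * L)"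
    "\<sigma>\<^sup>2 * \<tau> < 2 \<Longrightarrow> has_limit_variance M Y0 (piecewise_linear \<tau> \<mu> \<sigma> \<Delta> \<xi> Y0)
          (eL1\<^sup>2 * (exp (2 * \<Delta> / \<tau>)
                * (2 * L * Lt * (exp (\<Delta> / \<tau>) - 1) + Lb * (exp (\<Delta> / \<tau>) - 1)\<^sup>2
                   + L\<^sup>2 * (exp (\<Delta> * \<sigma>\<^sup>2) - exp (2 * \<Delta> / \<tau>)))
              / (exp (2 * \<Delta> / \<tau>) - exp (\<Delta> * \<sigma>\<^sup>2))))"
  proof -
    \<comment> \<open>The piecewise linear scheme is the case R = 1, where both correction moments
      are 1.\<close>
    have one: "(\<lambda>_. 1 :: real) \<in> borel_measurable borel" "has_bochner_integral M (\<lambda>\<omega>. 1 :: real) 1"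
      "has_bochner_integral M (\<lambda>\<omega>. (1 :: real)\<^sup>2) 1"
      by (simp_all only: measurable_const space_borel UNIV_I power_one \<xi>\<rho>.has_bochner_integral_const)
    note limits = \<xi>\<rho>.gbm_ode_limits[where \<mu> = \<mu> and R = "\<lambda>_. 1" and Y = "piecewise_linear \<tau> \<mu> \<sigma> \<Delta> \<xi> Y0",
        OF \<xi> pos one, unfolded mult_1_right]
    show "has_limit_mean M Y0 (piecewise_linear \<tau> \<mu> \<sigma> \<Delta> \<xi> Y0) (eL1 * exp (\<Delta> / \<tau>) * L)"
      unfolding eL1 L_def by (rule limits(1)) simp_all
    show "has_limit_variance M Y0 (piecewise_linear \<tau> \<mu> \<sigma> \<Delta> \<xi> Y0)
          (eL1\<^sup>2 * (exp (2 * \<Delta> / \<tau>)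
                * (2 * L * Lt * (exp (\<Delta> / \<tau>) - 1) + Lb * (exp (\<Delta> / \<tau>) - 1)\<^sup>2
                   + L\<^sup>2 * (exp (\<Delta> * \<sigma>\<^sup>2) - exp (2 * \<Delta> / \<tau>)))
              / (exp (2 * \<Delta> / \<tau>) - exp (\<Delta> * \<sigma>\<^sup>2))))"
      if "\<sigma>\<^sup>2 * \<tau> < 2"
      unfolding eL1 L_def Lt_def Lb_def by (rule limits(2)) (use that in simp_all)
  qed
  have R_meas: "(\<lambda>x. 1 - \<sigma> * x + \<sigma>\<^sup>2 * (3 / 5 * x\<^sup>2 + \<Delta> / 30)) \<in> borel_measurable borel"
    by measurable
  have K: "L_const \<tau> \<sigma> \<Delta> * (1 + \<sigma>\<^sup>2 * \<Delta> / 12) = K" "L_tilde \<tau> \<sigma> \<Delta> * (1 + \<sigma>\<^sup>2 * \<Delta> / 12) = Kt"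
    "L_bar \<tau> \<sigma> \<Delta> * (1 + \<sigma>\<^sup>2 * \<Delta> / 4 + 43 / 3600 * \<sigma> ^ 4 * \<Delta>\<^sup>2) = Kb"
    by (simp_all add: K_def Kt_def Kb_def K_const_def K_tilde_def K_bar_def)
  have Log: "has_limit_mean M Y0 (log_ode \<tau> \<mu> \<sigma> \<Delta> \<xi> \<rho> Y0) (eL1 * exp (\<Delta> / \<tau>) * K)"
    "\<sigma>\<^sup>2 * \<tau> < 2 \<Longrightarrow> has_limit_variance M Y0 (log_ode \<tau> \<mu> \<sigma> \<Delta> \<xi> \<rho> Y0)
          (eL1\<^sup>2 * (exp (2 * \<Delta> / \<tau>)
                * (2 * K * Kt * (exp (\<Delta> / \<tau>) - 1) + Kb * (exp (\<Delta> / \<tau>) - 1)\<^sup>2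
                   + K\<^sup>2 * (exp (\<Delta> * \<sigma>\<^sup>2) - exp (2 * \<Delta> / \<tau>)))
              / (exp (2 * \<Delta> / \<tau>) - exp (\<Delta> * \<sigma>\<^sup>2))))"
  proof -
    note limits = \<xi>\<rho>.gbm_ode_limits[where \<mu> = \<mu>
        and R = "\<lambda>x. 1 - \<sigma> * x + \<sigma>\<^sup>2 * (3 / 5 * x\<^sup>2 + \<Delta> / 30)" and Y = "log_ode \<tau> \<mu> \<sigma> \<Delta> \<xi> \<rho> Y0",
        OF \<xi> pos R_meas \<xi>\<rho>.log_ode_correction_moments[OF \<rho> pos(3)]]
    show "has_limit_mean M Y0 (log_ode \<tau> \<mu> \<sigma> \<Delta> \<xi> \<rho> Y0) (eL1 * exp (\<Delta> / \<tau>) * K)"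
      unfolding eL1 K[symmetric] by (rule limits(1)) simp_all
    show "has_limit_variance M Y0 (log_ode \<tau> \<mu> \<sigma> \<Delta> \<xi> \<rho> Y0)
          (eL1\<^sup>2 * (exp (2 * \<Delta> / \<tau>)
                * (2 * K * Kt * (exp (\<Delta> / \<tau>) - 1) + Kb * (exp (\<Delta> / \<tau>) - 1)\<^sup>2
                   + K\<^sup>2 * (exp (\<Delta> * \<sigma>\<^sup>2) - exp (2 * \<Delta> / \<tau>)))
              / (exp (2 * \<Delta> / \<tau>) - exp (\<Delta> * \<sigma>\<^sup>2))))"
      if "\<sigma>\<^sup>2 * \<tau> < 2"
      unfolding eL1 K[symmetric] by (rule limits(2)) (use that in simp_all)
  qed
  have Log_mean: "has_limit_mean M Y0 (log_ode \<tau> \<mu> \<sigma> \<Delta> \<xi> \<rho> Y0)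
        (eL1 * exp (\<Delta> / \<tau>) * L * (1 + \<sigma>\<^sup>2 * (\<Delta> / 12)))"
    using Log(1) unfolding K(1)[symmetric] L_def by (simp add: mult.assoc)
  have split_variance: "\<forall>Y \<in> {lie_trotter1 \<tau> \<mu> \<sigma> \<Delta> \<xi> Y0, lie_trotter2 \<tau> \<mu> \<sigma> \<Delta> \<xi> Y0, strang1 \<tau> \<mu> \<sigma> \<Delta> \<xi> Y0}.
      has_limit_variance M Y0 Y
        (eL1\<^sup>2 * (exp (2 * \<Delta> / \<tau>) * (exp (\<Delta> * \<sigma>\<^sup>2) - 1) / (exp (2 * \<Delta> / \<tau>) - exp (\<Delta> * \<sigma>\<^sup>2))))"
    if "\<sigma>\<^sup>2 * \<tau> < 2"
    using L1[OF that] L2(2)[OF that] S1(2)[OF that] by blast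
  note EM = \<xi>\<rho>.euler_maruyama_limits[OF \<xi> pos, of \<mu>] and Mil = \<xi>\<rho>.milstein_limits[OF \<xi> pos, of \<mu>]
  show ?thesis
    by (intro conjI impI; (elim conjE)?;
        (rule EM Mil L1_mean L2(1) S1(1) shifted S2 split_variance Lin Log_mean Log(2); assumption))
qed

end
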